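(* In the AR($p$) observation model described in the context, with observation matrix $\widehat{\mathbf H}=[\hat h_n(t)]_{n,t=0}^{N_r-1,T-1}$, define the biased and unbiased estimates of $r(k)$ by $$\hat r^{b}(0)=\hat r^{u}(0)=\frac{1}{\sigma_x^2N_rT}\sum_{n=0}^{N_r-1}\sum_{t=0}^{T-1}\hat h_n(t)\hat h_n(t)^*-\frac{\sigma_w^2}{\sigma_x^2},$$ and, for $1\le|k|\le T-1$, $$\hat r^{b}(k)=\frac{1}{\sigma_x^2N_rT}\sum_{n=0}^{N_r-1}\sum_{t}\hat h_n(t+k)\hat h_n(t)^*,\qquad \hat r^{u}(k)=\frac{1}{\sigma_x^2N_r(T-|k|)}\sum_{n=0}^{N_r-1}\sum_{t}\hat h_n(t+k)\hat h_n(t)^*,$$ where the sums over $t$ run over those $0\le t\le T-1$ with $0\le t+k\le T-1$. Then there is a constant $K'>0$, not depending on $N_r$, $T$, $k$ or $\epsilon$, such that for all $k=1-T,\ldots,T-1$ and all $\epsilon>0$, $$\mathbb P\left[\left|\hat r^{b}(k)-r(k)\right|\ge\epsilon\right]\le\frac{K'}{\epsilon^2N_rT},\qquad \mathbb P\left[\left|\hat r^{u}(k)-r(k)\right|\ge\epsilon\right]\le\frac{K'}{\epsilon^2N_r(T-|k|)} .$$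
   Context: Model. Fix an order $p\ge 1$, real coefficients $a_1,\ldots,a_p$, and known variances $\sigma_x^2>0$ and $\sigma_w^2\geq 0$, none of which depend on $N_r$ or $T$. For $n=0,\ldots,N_r-1$, the processes $(h_n(t))_{t\in\mathbb Z}$ are independent and identically distributed in $n$. Each is a zero-mean stationary circular complex Gaussian process satisfying the (causal) AR($p$) equation $$h_n(t)=a_1h_n(t-1)+\cdots+a_ph_n(t-p)+x_n(t),$$ where the $x_n(t)\sim\mathcal{CN}(0,\sigma_x^2)$ are i.i.d. in $n$ and $t$ and $x_n(t)$ is independent of the past $(h_n(s))_{s<t}$. The observations are $$\hat h_n(t)=h_n(t)+w_n(t),\qquad 0\le n\le N_r-1,\ 0\le t\le T-1,$$ where the $w_n(t)\sim\mathcal{CN}(0,\sigma_w^2)$ are i.i.d. and independent of all $h_n$. Here $\mathcal{CN}(0,\sigma^2)$ is the circular complex Gaussian law with mean $0$ and variance $\sigma^2$. Covariances. $r(k)=\sigma_x^{-2}\,\mathbb E[h_n(t)h_n(t-k)^*]$. It is assumed that $\sum_{k=1-T}^{T-1}|r(k)|\le K$ with $K$ a fixed constant independent of $T,N_r$. Equivalently in law, $\widehat{\mathbf H}=\mathbf X\mathbf R^{1/2}+\mathbf W$, where $\mathbf R$ is the $T\times T$ Toeplitz matrix with $(i,j)$ entry $r(i-j)$, and $\mathbf X,\mathbf W\in\mathbb C^{N_r\times T}$ are independent with i.i.d. $\mathcal{CN}(0,\sigma_x^2)$ and $\mathcal{CN}(0,\sigma_w^2)$ entries respectively. Asymptotic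 regime. $N_r=N_r(T)$ and $T$ tend to infinity with $N_r/T\to c$ for some $c\in(0,\infty)$; the pairs $(N_r,T)$ considered are those along this sequence. *)

theory Defs
  imports "HOL-Probability.Probability"
begin

text \<open>The law CN(0,v): the real and imaginary parts are independent N(0,v/2), so that
  E|Z|^2 = v; for v = 0 it is the point mass at 0.\<close>

definition cn_law :: "real \<Rightarrow> complex measure" where
  "cn_law v = (if v = 0 then return borel 0
     else density lborel (\<lambda>z. ennreal (exp (- (cmod z)\<^sup>2 / v) / (pi * v))))"

definition cn_distributed :: "'a measure \<Rightarrow> ('a \<Rightarrow> complex) \<Rightarrow> real \<Rightarrow> bool" where
  "cn_distributed M Z v \<longleftrightarrow> Z \<in> borel_measurable M \<and> distr M borel Z = cn_law v"

text \<open>Real Gaussian variables, degenerate (almost surely constant) ones included.\<close>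

definition real_gaussian :: "'a measure \<Rightarrow> ('a \<Rightarrow> real) \<Rightarrow> bool" where
  "real_gaussian M X \<longleftrightarrow> X \<in> borel_measurable M \<and>
     ((\<exists>\<mu>. AE \<omega> in M. X \<omega> = \<mu>) \<or>
      (\<exists>\<mu> \<sigma>. \<sigma> > 0 \<and> distributed M lborel X (\<lambda>x. ennreal (normal_density \<mu> \<sigma> x))))"

text \<open>The law of a complex process indexed by the integers, on the product sigma-algebra.\<close>

abbreviation path_space :: "(int \<Rightarrow> complex) measure" where
  "path_space \<equiv> PiM UNIV (\<lambda>_. borel)"

definition path_law :: "'a measure \<Rightarrow> (int \<Rightarrow> 'a \<Rightarrow> complex) \<Rightarrow> (int \<Rightarrow> complex) measure" where
  "path_law M h = distr M path_space (\<lambda>\<omega> t. h t \<omega>)"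

text \<open>Joint Gaussianity: the random variables Re (sum of c t * h t) are exactly the real linear
  combinations of real and imaginary parts of the process.
  Circularity: the law is invariant under multiplication by unit complex numbers.\<close>

definition circular_gaussian_process :: "'a measure \<Rightarrow> (int \<Rightarrow> 'a \<Rightarrow> complex) \<Rightarrow> bool" where
  "circular_gaussian_process M h \<longleftrightarrow>
     (\<forall>t. h t \<in> borel_measurable M) \<and>
     (\<forall>F c. finite F \<longrightarrow> real_gaussian M (\<lambda>\<omega>. Re (\<Sum>t\<in>F. c t * h t \<omega>))) \<and>
     (\<forall>\<theta>. path_law M (\<lambda>t \<omega>. cis \<theta> * h t \<omega>) = path_law M h)"

definition zero_mean :: "'a measure \<Rightarrow> (int \<Rightarrow> 'a \<Rightarrow> complex) \<Rightarrow> bool" where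
  "zero_mean M h \<longleftrightarrow> (\<forall>t. integrable M (h t) \<and> (LINT \<omega>|M. h t \<omega>) = 0)"

definition stationary :: "'a measure \<Rightarrow> (int \<Rightarrow> 'a \<Rightarrow> complex) \<Rightarrow> bool" where
  "stationary M h \<longleftrightarrow> (\<forall>s. path_law M (\<lambda>t. h (t + s)) = path_law M h)"

text \<open>The observation model for one pair \<open>(Nr, T)\<close>; \<open>vx\<close> and \<open>vw\<close> are the variances of the
  innovations \<open>x\<close> and of the observation noise \<open>w\<close>.  Independence of \<open>x n t\<close> from the past of
  \<open>h n\<close> makes the autoregression causal.\<close>

locale ar_observation = prob_space M
  for M :: "'a measure" +
  fixes p :: nat and a :: "nat \<Rightarrow> real" and vx vw :: real and Nr T :: nat
    and h x w :: "nat \<Rightarrow> int \<Rightarrow> 'a \<Rightarrow> complex"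
  assumes order_pos: "p \<ge> 1"
    and vx_pos: "vx > 0"
    and vw_nonneg: "vw \<ge> 0"
    and Nr_pos: "Nr \<ge> 1"
    and T_pos: "T \<ge> 1"
    and h_gaussian: "\<And>n. n < Nr \<Longrightarrow> circular_gaussian_process M (h n)"
    and h_zero_mean: "\<And>n. n < Nr \<Longrightarrow> zero_mean M (h n)"
    and h_stationary: "\<And>n. n < Nr \<Longrightarrow> stationary M (h n)"
    and h_indep: "indep_vars (\<lambda>_. path_space) (\<lambda>n \<omega> t. h n t \<omega>) {..<Nr}"
    and h_ident: "\<And>m n. m < Nr \<Longrightarrow> n < Nr \<Longrightarrow> path_law M (h m) = path_law M (h n)"
    and ar_equation: "\<And>n t. n < Nr \<Longrightarrow>
      AE \<omega> in M. h n t \<omega> = (\<Sum>i=1..p. complex_of_real (a i) * h n (t - int i) \<omega>) + x n t \<omega>"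
    and x_law: "\<And>n t. n < Nr \<Longrightarrow> cn_distributed M (x n t) vx"
    and x_indep: "indep_vars (\<lambda>_. borel) (\<lambda>(n, t). x n t) ({..<Nr} \<times> UNIV)"
    and x_indep_past: "\<And>n t. n < Nr \<Longrightarrow>
      indep_set (sets (vimage_algebra (space M) (x n t) borel))
        (sets (vimage_algebra (space M) (\<lambda>\<omega>. \<lambda>s\<in>{..<t}. h n s \<omega>) (PiM {..<t} (\<lambda>_. borel))))"
    and w_law: "\<And>n t. n < Nr \<Longrightarrow> t \<in> {0..int T - 1} \<Longrightarrow> cn_distributed M (w n t) vw"
    and w_indep: "indep_vars (\<lambda>_. borel) (\<lambda>(n, t). w n t) ({..<Nr} \<times> {0..int T - 1})"
    and w_indep_h: "indep_var
      (PiM ({..<Nr} \<times> {0..int T - 1}) (\<lambda>_. borel))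
      (\<lambda>\<omega>. \<lambda>(n, t)\<in>{..<Nr} \<times> {0..int T - 1}. w n t \<omega>)
      (PiM ({..<Nr} \<times> UNIV) (\<lambda>_. borel))
      (\<lambda>\<omega>. \<lambda>(n, t)\<in>{..<Nr} \<times> UNIV. h n t \<omega>)"

text \<open>The normalised covariance \<open>r k\<close>, read off at n = 0 and t = 0; in the model every other
  choice of n and t gives the same value, see \<open>autocov_eq\<close> below.\<close>

definition autocov ::
  "'a measure \<Rightarrow> real \<Rightarrow> (nat \<Rightarrow> int \<Rightarrow> 'a \<Rightarrow> complex) \<Rightarrow> int \<Rightarrow> complex" where
  "autocov M vx h k = (LINT \<omega>|M. h 0 0 \<omega> * cnj (h 0 (0 - k) \<omega>)) / complex_of_real vx"

lemma (in ar_observation) autocov_eq: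
  assumes n: "n < Nr"
  shows "autocov M vx h k = (LINT \<omega>|M. h n t \<omega> * cnj (h n (t - k) \<omega>)) / complex_of_real vx"
proof -
  let ?g = "\<lambda>f. f 0 * cnj (f (0 - k) :: complex)"
  have g: "?g \<in> borel_measurable path_space"
  proof -
    have [measurable]: "cnj \<in> borel_measurable borel"
      by (intro borel_measurable_continuous_onI continuous_intros)
    show ?thesis by measurable
  qed
  have via_law: "(LINT \<omega>|M. f 0 \<omega> * cnj (f (0 - k) \<omega>)) = (LINT y|path_law M f. ?g y)"
    if "\<And>t. f t \<in> borel_measurable M" for f
  proof -
    have "(\<lambda>\<omega> t. f t \<omega>) \<in> measurable M path_space"
      using that by (intro measurable_PiM_single') auto
    from integral_distr[OF this g] show ?thesis
      by (simp add: path_law_def)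
  qed
  have meas: "h m s \<in> borel_measurable M" if "m < Nr" for m s
    using h_gaussian[OF that] by (simp add: circular_gaussian_process_def)
  have "0 < Nr" using Nr_pos by simp
  have "(LINT \<omega>|M. h n t \<omega> * cnj (h n (t - k) \<omega>)) = (LINT y|path_law M (\<lambda>s. h n (s + t)). ?g y)"
    using via_law[of "\<lambda>s. h n (s + t)"] meas[OF n] by simp
  also have "\<dots> = (LINT y|path_law M (h 0). ?g y)"
    using h_stationary[OF n] h_ident[OF n \<open>0 < Nr\<close>] by (simp add: stationary_def)
  also have "\<dots> = (LINT \<omega>|M. h 0 0 \<omega> * cnj (h 0 (0 - k) \<omega>))"
    using via_law[of "h 0"] meas[OF \<open>0 < Nr\<close>] by simp
  finally show ?thesis
    by (simp add: autocov_def)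
qed

definition observation ::
  "(nat \<Rightarrow> int \<Rightarrow> 'a \<Rightarrow> complex) \<Rightarrow> (nat \<Rightarrow> int \<Rightarrow> 'a \<Rightarrow> complex) \<Rightarrow> 'a \<Rightarrow> nat \<Rightarrow> int \<Rightarrow> complex" where
  "observation h w \<omega> n t = h n t \<omega> + w n t \<omega>"

definition lag_sum :: "nat \<Rightarrow> nat \<Rightarrow> (nat \<Rightarrow> int \<Rightarrow> complex) \<Rightarrow> int \<Rightarrow> complex" where
  "lag_sum Nr T H k =
     (\<Sum>n<Nr. \<Sum>t | t \<in> {0..int T - 1} \<and> t + k \<in> {0..int T - 1}. H n (t + k) * cnj (H n t))"

definition biased_est ::
  "real \<Rightarrow> real \<Rightarrow> nat \<Rightarrow> nat \<Rightarrow> (nat \<Rightarrow> int \<Rightarrow> complex) \<Rightarrow> int \<Rightarrow> complex" where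
  "biased_est vx vw Nr T H k =
     (if k = 0
      then lag_sum Nr T H 0 / complex_of_real (vx * real Nr * real T) - complex_of_real (vw / vx)
      else lag_sum Nr T H k / complex_of_real (vx * real Nr * real T))"

definition unbiased_est ::
  "real \<Rightarrow> real \<Rightarrow> nat \<Rightarrow> nat \<Rightarrow> (nat \<Rightarrow> int \<Rightarrow> complex) \<Rightarrow> int \<Rightarrow> complex" where
  "unbiased_est vx vw Nr T H k =
     (if k = 0 then biased_est vx vw Nr T H 0
      else lag_sum Nr T H k / complex_of_real (vx * real Nr * (real T - real_of_int \<bar>k\<bar>)))"

end

theory Submission
  imports Defs
begin

text \<open>
  Chebyshev's inequality reduces both bounds to second moments. The observations are jointly
  circular Gaussian, so Wick's formula bounds the variance of a lag sum by
  \<open>\<Sum>s. \<Sum>t. |\<gamma> (s - t)|\<^sup>2\<close> for each antenna, where \<open>\<gamma>\<close> is the covariance of the observations; this is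
  at most \<open>T - |k|\<close> times \<open>(vx * K + vw)\<^sup>2\<close>. Only the moment identities \<open>E Z = E Z\<^sup>2 = 0\<close> and
  \<open>E |Z|\<^sup>4 = 2 (E |Z|\<^sup>2)\<^sup>2\<close> for all linear combinations \<open>Z\<close> of the observations enter: they are stable
  under independent sums, and polarisation turns them into Wick's formula.

  The bias of the biased estimate is \<open>|k| r(k) / T\<close>. As \<open>Nr / T\<close> is bounded, its square is
  \<open>O(1 / (Nr T))\<close> as soon as \<open>|k| |r(k)|\<close> is bounded. This follows from the recursion for \<open>r\<close>: the
  impulse response is square summable because the variance of \<open>h\<close> dominates its energy, so it tends
  to 0, and a high enough power of the companion matrix has first row of norm at most \<open>1/2\<close>.
  That power depends on the coefficients \<open>a\<close> only, which makes the bound uniform.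
\<close>

section \<open>Linear recursions\<close>

text \<open>First row of the \<open>m\<close>-th power of the companion matrix of \<open>a\<close>, with columns indexed by
  \<open>1..p\<close>; its first entry is the \<open>m\<close>-th impulse response coefficient.\<close>

primrec companion_row :: "nat \<Rightarrow> (nat \<Rightarrow> real) \<Rightarrow> nat \<Rightarrow> nat \<Rightarrow> real" where
  "companion_row p a 0 i = (if i = 1 then 1 else 0)"
| "companion_row p a (Suc m) i = companion_row p a m 1 * a i + (if i < p then companion_row p a m (Suc i) else 0)"

text \<open>The defect of the recursion at \<open>s\<close> stays a separate term, so that one
  identity serves two sequences: for the autocovariances the defect vanishes, for the paths of the
  process it is the innovation. Splitting off \<open>u s\<close> and shifting the other columns by
  one produces the next companion row.\<close>

lemma companion_row_step:
  fixes u :: "int \<Rightarrow> complex"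
  assumes "p \<ge> 1"
  shows "(\<Sum>i=1..p. of_real (companion_row p a m i) * u (s - int i + 1)) =
    of_real (companion_row p a m 1) * (u s - (\<Sum>i=1..p. of_real (a i) * u (s - int i))) +
    (\<Sum>i=1..p. of_real (companion_row p a (Suc m) i) * u (s - int i))"
proof -
  let ?c = "companion_row p a m"
  have "(\<Sum>i=1..p. of_real (?c i) * u (s - int i + 1)) =
      of_real (?c 1) * u s + (\<Sum>i=Suc 1..p. of_real (?c i) * u (s - int i + 1))"
    using assms by (simp add: sum.atLeast_Suc_atMost)
  also have "(\<Sum>i=Suc 1..p. of_real (?c i) * u (s - int i + 1)) =
      (\<Sum>i\<in>{1..<p}. of_real (?c (Suc i)) * u (s - int i))"
    using sum.shift_bounds_Suc_ivl[of "\<lambda>i. complex_of_real (?c i) * u (s - int i + 1)" 1 p]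
    by (simp add: atLeastLessThanSuc_atLeastAtMost)
  also have "\<dots> = (\<Sum>i=1..p. of_real (if i < p then ?c (Suc i) else 0) * u (s - int i))"
    by (rule sum.mono_neutral_cong_left) auto
  finally show ?thesis
    by (simp add: algebra_simps sum_distrib_left sum.distrib)
qed

text \<open>The last column is \<open>a p\<close> times column 1, delayed by one step; column
  \<open>i\<close> is \<open>a i\<close> times column 1 plus column \<open>Suc i\<close>, both
  delayed. Hence the induction runs downwards from \<open>p\<close>.\<close>

lemma companion_row_tendsto_0:
  assumes "(\<lambda>m. companion_row p a m 1) \<longlonglongrightarrow> 0" and "1 \<le> i" "i \<le> p"
  shows "(\<lambda>m. companion_row p a m i) \<longlonglongrightarrow> 0"
  using assms(3,2)
proof (induction i rule: inc_induct)
  case base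
  have "(\<lambda>m. companion_row p a (Suc m) p) \<longlonglongrightarrow> 0"
    using tendsto_mult_right[OF assms(1), of "a p"] by simp
  then show ?case by (rule LIMSEQ_imp_Suc)
next
  case (step i)
  have "(\<lambda>m. companion_row p a m 1 * a i + companion_row p a m (Suc i)) \<longlonglongrightarrow> 0 * a i + 0"
    using step by (intro tendsto_add tendsto_mult assms(1) tendsto_const) auto
  then have "(\<lambda>m. companion_row p a (Suc m) i) \<longlonglongrightarrow> 0"
    using step.hyps by simp
  then show ?case by (rule LIMSEQ_imp_Suc)
qed

lemma recursion_iterate:
  fixes u :: "int \<Rightarrow> complex"
  assumes p: "p \<ge> 1" and rec: "\<And>j. j \<ge> 1 \<Longrightarrow> u j = (\<Sum>i=1..p. of_real (a i) * u (j - int i))"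
    and "int m \<le> k"
  shows "u k = (\<Sum>i=1..p. of_real (companion_row p a m i) * u (k - int m - int i + 1))"
  using \<open>int m \<le> k\<close>
proof (induction m)
  case 0
  have "(\<Sum>i=1..p. of_real (companion_row p a 0 i) * u (k - int i + 1)) =
      (\<Sum>i=1..p. if i = 1 then u k else 0)"
    by (rule sum.cong) auto
  then show ?case using p by simp
next
  \<comment> \<open>From \<open>int (Suc m) \<le> k\<close> the index \<open>k - int m\<close> is at
    least 1, which is where the recursion may be applied.\<close>
  case (Suc m)
  then show ?case
    using companion_row_step[OF p, of a m u "k - int m"] rec[of "k - int m"]
    by (simp add: algebra_simps)
qed

text \<open>The decay is in fact exponential, but a bound on \<open>k\<close> times the modulus is
  all that the bias requires, and one strong induction gives it. Below \<open>2 * (N + p)\<close>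
  the uniform bound \<open>K\<close> suffices.\<close>

lemma recursion_decay:
  fixes u :: "int \<Rightarrow> complex"
  assumes p: "p \<ge> 1" and rec: "\<And>j. j \<ge> 1 \<Longrightarrow> u j = (\<Sum>i=1..p. of_real (a i) * u (j - int i))"
    and bound: "\<And>j. cmod (u j) \<le> K"
    and N: "(\<Sum>i=1..p. \<bar>companion_row p a N i\<bar>) \<le> 1 / 2"
  shows "real k * cmod (u (int k)) \<le> 2 * real (N + p) * K"
proof (induction k rule: less_induct)
  case (less k)
  have K: "0 \<le> K" using bound[of 0] norm_ge_zero order_trans by blast
  show ?case
  proof (cases "k < 2 * (N + p)")
    case True
    have "real k * cmod (u (int k)) \<le> real (2 * (N + p)) * K"
      using True bound by (intro mult_mono) (auto simp del: of_nat_mult of_nat_add)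
    then show ?thesis by simp
  next
    case False
    \<comment> \<open>The unrolled recursion only reaches indices above \<open>k / 2\<close>, so the contraction factor \<open>1 / 2\<close>
      makes up for the weight \<open>k\<close>.\<close>
    have "N \<noteq> 0"
    proof
      assume "N = 0"
      then have "(\<Sum>i=1..p. \<bar>companion_row p a N i\<bar>) = (\<Sum>i=1..p. if i = 1 then 1 else 0)"
        by (intro sum.cong) auto
      with N p show False by simp
    qed
    define D where "D = 2 * real (N + p) * K"
    have D: "0 \<le> D" using K by (simp add: D_def)
    have each: "real k * cmod (u (int k - int N - int i + 1)) \<le> 2 * D" if i: "i \<in> {1..p}" for i
    proof -
      let ?j = "k - N - i + 1"
      have j: "?j < k" "k \<le> 2 * ?j" "int ?j = int k - int N - int i + 1" 
        using i False \<open>N \<noteq> 0\<close> by auto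
      have "real k * cmod (u (int ?j)) \<le> real (2 * ?j) * cmod (u (int ?j))"
        using j by (intro mult_right_mono) (auto simp del: of_nat_mult)
      also have "\<dots> = 2 * (real ?j * cmod (u (int ?j)))"
        by (simp only: of_nat_mult mult.assoc of_nat_numeral)
      also have "\<dots> \<le> 2 * D"
        using less[OF j(1)] by (simp only: D_def)
      finally show ?thesis using j(3) by (simp only:)
    qed
    have "real k * cmod (u (int k)) =
      real k * cmod (\<Sum>i=1..p. of_real (companion_row p a N i) * u (int k - int N - int i + 1))"
      using recursion_iterate[OF p rec, of N "int k"] False by simp
    also have "\<dots> \<le> real k * (\<Sum>i=1..p. \<bar>companion_row p a N i\<bar> * cmod (u (int k - int N - int i + 1)))"
      by (intro mult_left_mono order_trans[OF norm_sum] sum_mono) (auto simp: norm_mult)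
    also have "\<dots> = (\<Sum>i=1..p. \<bar>companion_row p a N i\<bar> * (real k * cmod (u (int k - int N - int i + 1))))"
      by (simp add: sum_distrib_left mult_ac)
    also have "\<dots> \<le> (\<Sum>i=1..p. \<bar>companion_row p a N i\<bar> * (2 * D))"
      using each by (intro sum_mono mult_left_mono) auto
    also have "\<dots> = (\<Sum>i=1..p. \<bar>companion_row p a N i\<bar>) * (2 * D)"
      by (simp add: sum_distrib_right)
    also have "\<dots> \<le> 1 / 2 * (2 * D)" using N D by (intro mult_right_mono) auto
    finally show ?thesis by (simp add: D_def)
  qed
qed

lemma companion_row_small:
  assumes "(\<lambda>m. companion_row p a m 1) \<longlonglongrightarrow> 0"
  shows "\<exists>N. (\<Sum>i=1..p. \<bar>companion_row p a N i\<bar>) \<le> 1 / 2"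
proof -
  have "(\<lambda>m. \<Sum>i=1..p. \<bar>companion_row p a m i\<bar>) \<longlonglongrightarrow> (\<Sum>i=1..p. \<bar>0\<bar>)"
    using companion_row_tendsto_0[OF assms] by (intro tendsto_sum tendsto_rabs) auto
  then have "eventually (\<lambda>m. (\<Sum>i=1..p. \<bar>companion_row p a m i\<bar>) < 1 / 2) sequentially"
    by (rule order_tendstoD) simp
  then show ?thesis by (auto simp: eventually_sequentially intro: less_imp_le)
qed

section \<open>Moments of circular Gaussian variables\<close>

text \<open>The vanishing of E Z and E Z^2 removes the cross terms in independent sums; the fourth
  moment identity is what polarisation turns into Wick's formula. Degenerate variables such as Z = 0
  are included.\<close>

definition gaussian_moments :: "'a measure \<Rightarrow> ('a \<Rightarrow> complex) \<Rightarrow> bool" where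
  "gaussian_moments M Z \<longleftrightarrow> Z \<in> borel_measurable M \<and> integrable M (\<lambda>\<omega>. cmod (Z \<omega>) ^ 4) \<and>
     (LINT \<omega>|M. Z \<omega>) = 0 \<and> (LINT \<omega>|M. (Z \<omega>)\<^sup>2) = 0 \<and>
     (LINT \<omega>|M. cmod (Z \<omega>) ^ 4) = 2 * (LINT \<omega>|M. (cmod (Z \<omega>))\<^sup>2)\<^sup>2"

lemma le_one_plus_power4:
  fixes x :: real assumes "0 \<le> x"
  shows "x \<le> 1 + x ^ 4" "x\<^sup>2 \<le> 1 + x ^ 4" "x ^ 3 \<le> 1 + x ^ 4"
proof -
  have "x ^ j \<le> 1 + x ^ 4" if "j \<le> 4" for j
  proof (cases "x \<le> 1")
    case True
    with assms have "x ^ j \<le> 1" by (simp add: power_le_one)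
    also have "1 \<le> 1 + x ^ 4" by simp
    finally show ?thesis .
  next
    case False
    with that have "x ^ j \<le> x ^ 4" by (intro power_increasing) auto
    then show ?thesis by simp
  qed
  from this[of 1] this[of 2] this[of 3]
  show "x \<le> 1 + x ^ 4" "x\<^sup>2 \<le> 1 + x ^ 4" "x ^ 3 \<le> 1 + x ^ 4" by simp_all
qed

lemma prod_le_sum_power4:
  fixes p q r s :: real
  assumes "0 \<le> p" "0 \<le> q" "0 \<le> r" "0 \<le> s"
  shows "p * q * r * s \<le> p ^ 4 + q ^ 4 + r ^ 4 + s ^ 4"
proof -
  define m where "m = max (max p q) (max r s)"
  have m: "p \<le> m" "q \<le> m" "r \<le> m" "s \<le> m" "0 \<le> m" using assms by (auto simp: m_def)
  have "p * q * r * s \<le> m * m * m * m"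
    using assms m by (intro mult_mono mult_nonneg_nonneg) auto
  also have "\<dots> = m ^ 4" by (simp add: power4_eq_xxxx)
  also have "\<dots> \<le> p ^ 4 + q ^ 4 + r ^ 4 + s ^ 4"
    using assms by (auto simp: m_def max_def)
  finally show ?thesis .
qed

lemma borel_measurable_cnj[measurable]: "cnj \<in> borel_measurable borel"
  by (intro borel_measurable_continuous_onI continuous_intros)

context prob_space
begin

lemma integrable_of_power4_bound:
  fixes f :: "'a \<Rightarrow> 'b :: {banach, second_countable_topology}" and g :: "'a \<Rightarrow> real"
  assumes "f \<in> borel_measurable M" "integrable M (\<lambda>\<omega>. g \<omega> ^ 4)"
    and "\<And>\<omega>. norm (f \<omega>) \<le> 1 + g \<omega> ^ 4"
  shows "integrable M f"
  by (rule Bochner_Integration.integrable_bound[of M "\<lambda>\<omega>. 1 + g \<omega> ^ 4"])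
     (use assms in \<open>auto intro!: AE_I2 order_trans[OF assms(3)]\<close>)

lemma real_gaussian_moments:
  assumes "real_gaussian M X" and "(LINT \<omega>|M. X \<omega>) = 0"
  shows "integrable M (\<lambda>\<omega>. X \<omega> ^ 4)"
    and "(LINT \<omega>|M. X \<omega> ^ 4) = 3 * (LINT \<omega>|M. (X \<omega>)\<^sup>2)\<^sup>2"
proof -
  have X[measurable]: "X \<in> borel_measurable M" using assms by (simp add: real_gaussian_def)
  have "integrable M (\<lambda>\<omega>. X \<omega> ^ 4) \<and> (LINT \<omega>|M. X \<omega> ^ 4) = 3 * (LINT \<omega>|M. (X \<omega>)\<^sup>2)\<^sup>2"
    using assms(1) unfolding real_gaussian_def
  proof (elim conjE disjE exE)
    fix \<mu> assume ae: "AE \<omega> in M. X \<omega> = \<mu>"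
    have "(LINT \<omega>|M. X \<omega>) = (LINT \<omega>|M. \<mu>)"
      using ae by (intro integral_cong_AE) auto
    with assms(2) have mu: "\<mu> = 0" by (simp add: prob_space)
    have ae0: "AE \<omega> in M. X \<omega> ^ 4 = 0" "AE \<omega> in M. (X \<omega>)\<^sup>2 = 0"
      using ae mu by auto
    have "integrable M (\<lambda>\<omega>. X \<omega> ^ 4) = integrable M (\<lambda>\<omega>. 0::real)"
      using ae0 by (intro integrable_cong_AE) auto
    moreover have "(LINT \<omega>|M. X \<omega> ^ 4) = (LINT \<omega>|M. (0::real))"
      using ae0 by (intro integral_cong_AE) auto
    moreover have "(LINT \<omega>|M. (X \<omega>)\<^sup>2) = (LINT \<omega>|M. (0::real))"
      using ae0 by (intro integral_cong_AE) auto
    ultimately show ?thesis by simp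
  next
    fix \<mu> \<sigma> :: real
    assume s: "0 < \<sigma>" and d: "distributed M lborel X (\<lambda>x. ennreal (normal_density \<mu> \<sigma> x))"
    have "(LINT \<omega>|M. X \<omega>) = \<mu>"
      using distributed_integral[OF d, of "\<lambda>x. x"] integral_normal_moment_nz_1[OF s, of \<mu>] by simp
    with assms(2) have mu: "\<mu> = 0" by simp
    have "(LINT \<omega>|M. X \<omega> ^ 4) = 3 * \<sigma> ^ 4"
      using distributed_integral[OF d, of "\<lambda>x. x ^ 4"] integral_normal_moment_even[OF s, of \<mu> 2] mu s
      by (simp add: fact_numeral power_divide)
    moreover have "(LINT \<omega>|M. (X \<omega>)\<^sup>2) = \<sigma>\<^sup>2"
      using distributed_integral[OF d, of "\<lambda>x. x ^ 2"] integral_normal_moment_even[OF s, of \<mu> 1] mu s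
      by (simp add: fact_numeral power_divide)
    moreover have "integrable M (\<lambda>\<omega>. X \<omega> ^ 4)"
      using distributed_integrable[OF d, of "\<lambda>x. x ^ 4"] integrable_normal_moment[OF s, of \<mu> 4] mu
      by simp
    ultimately show ?thesis by simp
  qed
  then show "integrable M (\<lambda>\<omega>. X \<omega> ^ 4)"
    and "(LINT \<omega>|M. X \<omega> ^ 4) = 3 * (LINT \<omega>|M. (X \<omega>)\<^sup>2)\<^sup>2" by auto
qed

lemma gaussian_moments_integrable:
  assumes "gaussian_moments M Z"
  shows "integrable M Z" "integrable M (\<lambda>\<omega>. (cmod (Z \<omega>))\<^sup>2)" "integrable M (\<lambda>\<omega>. (Z \<omega>)\<^sup>2)"
    "integrable M (\<lambda>\<omega>. cmod (Z \<omega>) ^ 3)"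
proof -
  have [measurable]: "Z \<in> borel_measurable M" and 4: "integrable M (\<lambda>\<omega>. cmod (Z \<omega>) ^ 4)"
    using assms by (auto simp: gaussian_moments_def)
  show "integrable M Z" "integrable M (\<lambda>\<omega>. (cmod (Z \<omega>))\<^sup>2)" "integrable M (\<lambda>\<omega>. (Z \<omega>)\<^sup>2)"
    "integrable M (\<lambda>\<omega>. cmod (Z \<omega>) ^ 3)"
    by (rule integrable_of_power4_bound[OF _ 4];
        simp add: le_one_plus_power4 norm_power)+
qed

lemma gaussian_moments_integrable_prod4:
  assumes "gaussian_moments M a" "gaussian_moments M b" "gaussian_moments M c" "gaussian_moments M d"
  shows "integrable M (\<lambda>\<omega>. a \<omega> * b \<omega> * cnj (c \<omega>) * cnj (d \<omega>))"
proof (rule Bochner_Integration.integrable_bound)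
  have [measurable]: "a \<in> borel_measurable M" "b \<in> borel_measurable M"
    "c \<in> borel_measurable M" "d \<in> borel_measurable M"
    using assms by (auto simp: gaussian_moments_def)
  show "integrable M (\<lambda>\<omega>. cmod (a \<omega>) ^ 4 + cmod (b \<omega>) ^ 4 + cmod (c \<omega>) ^ 4 + cmod (d \<omega>) ^ 4)"
    using assms by (auto simp: gaussian_moments_def)
  show "(\<lambda>\<omega>. a \<omega> * b \<omega> * cnj (c \<omega>) * cnj (d \<omega>)) \<in> borel_measurable M"
    by measurable
  show "AE \<omega> in M. norm (a \<omega> * b \<omega> * cnj (c \<omega>) * cnj (d \<omega>)) \<le>
     norm (cmod (a \<omega>) ^ 4 + cmod (b \<omega>) ^ 4 + cmod (c \<omega>) ^ 4 + cmod (d \<omega>) ^ 4)"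
    by (intro AE_I2) (simp add: norm_mult abs_of_nonneg prod_le_sum_power4)
qed

lemma integrable_mult_cnj:
  fixes a b :: "'a \<Rightarrow> complex"
  assumes [measurable]: "a \<in> borel_measurable M" "b \<in> borel_measurable M"
    and "integrable M (\<lambda>\<omega>. (cmod (a \<omega>))\<^sup>2)" "integrable M (\<lambda>\<omega>. (cmod (b \<omega>))\<^sup>2)"
  shows "integrable M (\<lambda>\<omega>. a \<omega> * cnj (b \<omega>))"
proof (rule Bochner_Integration.integrable_bound)
  show "integrable M (\<lambda>\<omega>. (cmod (a \<omega>))\<^sup>2 + (cmod (b \<omega>))\<^sup>2)"
    using assms by auto
  have "x * y \<le> x\<^sup>2 + y\<^sup>2" if "0 \<le> x" "0 \<le> y" for x y :: real
    using sum_squares_bound[of x y] mult_nonneg_nonneg[OF that] by linarith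
  then show "AE \<omega> in M. norm (a \<omega> * cnj (b \<omega>)) \<le> norm ((cmod (a \<omega>))\<^sup>2 + (cmod (b \<omega>))\<^sup>2)"
    by (intro AE_I2) (simp add: norm_mult)
qed measurable

lemma gaussian_moments_integrable_mult_cnj:
  assumes "gaussian_moments M a" "gaussian_moments M b"
  shows "integrable M (\<lambda>\<omega>. a \<omega> * cnj (b \<omega>))"
  using assms gaussian_moments_integrable(2)
  by (intro integrable_mult_cnj) (auto simp: gaussian_moments_def)

text \<open>Circularity enters only through E Z^2 = 0. For \<open>cmod u = 1\<close> it makes Re (u
  Z) a centred real Gaussian of variance E |Z|^2 / 2, whose fourth moment is three times its squared
  variance.\<close>

lemma gaussian_moments_circular_process:
  assumes h: "circular_gaussian_process M h" "zero_mean M h" and F: "finite F"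
  shows "gaussian_moments M (\<lambda>\<omega>. \<Sum>t\<in>F. c t * h t \<omega>)"
proof -
  define Z where "Z = (\<lambda>\<omega>. \<Sum>t\<in>F. c t * h t \<omega>)"
  have hm[measurable]: "h t \<in> borel_measurable M" for t
    using h by (simp add: circular_gaussian_process_def)
  have hi: "integrable M (h t)" "(LINT \<omega>|M. h t \<omega>) = 0" for t
    using h by (auto simp: zero_mean_def)
  have Zm[measurable]: "Z \<in> borel_measurable M" unfolding Z_def by measurable
  have Zi: "integrable M Z" "(LINT \<omega>|M. Z \<omega>) = 0"
    using hi by (simp_all add: Z_def Bochner_Integration.integral_sum)
  have gauss: "real_gaussian M (\<lambda>\<omega>. Re (u * Z \<omega>))" for u
  proof -
    have "real_gaussian M (\<lambda>\<omega>. Re (\<Sum>t\<in>F. (u * c t) * h t \<omega>))"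
      using h(1)[unfolded circular_gaussian_process_def, THEN conjunct2, THEN conjunct1, rule_format, OF F] .
    then show ?thesis unfolding Z_def sum_distrib_left mult.assoc .
  qed
  have mean0: "(LINT \<omega>|M. Re (u * Z \<omega>)) = 0" for u
    using Zi by (subst integral_Re) auto
  have i4: "integrable M (\<lambda>\<omega>. (Re (u * Z \<omega>)) ^ 4)"
    and m4: "(LINT \<omega>|M. (Re (u * Z \<omega>)) ^ 4) = 3 * (LINT \<omega>|M. (Re (u * Z \<omega>))\<^sup>2)\<^sup>2" for u
    using real_gaussian_moments[OF gauss mean0] by auto
  have cmod4: "cmod z ^ 4 = ((Re z)\<^sup>2 + (Im z)\<^sup>2)\<^sup>2" for z
    using power_mult[of "cmod z" 2 2] by (simp add: cmod_power2)
  define s :: real where "s = sqrt (1/2)"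
  have s: "s\<^sup>2 = 1/2" "s ^ 4 = 1/4" by (simp_all add: s_def power_divide real_sqrt_power[symmetric] numeral_eq_Suc)
  \<comment> \<open>Averaging over four rotations by \<open>\<pi>/4\<close> expresses \<open>|Z|\<^sup>4\<close> through fourth powers of real
    Gaussian variables.\<close>
  have avg4: "cmod z ^ 4 = 2/3 * ((Re (1 * z)) ^ 4 + (Re (\<i> * z)) ^ 4 +
      (Re (Complex s s * z)) ^ 4 + (Re (Complex s (-s) * z)) ^ 4)" for z
  proof -
    have "(Re (Complex s s * z)) ^ 4 = s ^ 4 * (Re z - Im z) ^ 4"
      "(Re (Complex s (-s) * z)) ^ 4 = s ^ 4 * (Re z + Im z) ^ 4"
      by (simp_all add: right_diff_distrib[symmetric] distrib_left[symmetric] power_mult_distrib)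
    then show ?thesis unfolding cmod4 s(2) by (simp add: power2_eq_square power4_eq_xxxx algebra_simps)
  qed
  have Z4: "integrable M (\<lambda>\<omega>. cmod (Z \<omega>) ^ 4)"
    unfolding avg4 using i4 by (intro integrable_mult_right Bochner_Integration.integrable_add) 
  have Z2: "integrable M (\<lambda>\<omega>. (Z \<omega>)\<^sup>2)" "integrable M (\<lambda>\<omega>. (cmod (Z \<omega>))\<^sup>2)"
    by (rule integrable_of_power4_bound[OF _ Z4]; simp add: le_one_plus_power4 norm_power)+
  \<comment> \<open>Multiplication by \<open>cis (pi/2)\<close>, that is by the imaginary unit,
    preserves the law of the process and changes the sign of the square of the sum; so the
    expectation equals its own negative.\<close>
  have E2: "(LINT \<omega>|M. (Z \<omega>)\<^sup>2) = 0"
  proof -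
    let ?g = "\<lambda>f. (\<Sum>t\<in>F. c t * f t)\<^sup>2"
    have g: "?g \<in> borel_measurable path_space" by measurable
    have via: "(LINT \<omega>|M. ?g (\<lambda>t. f t \<omega>)) = (LINT y|path_law M f. ?g y)"
      if "\<And>t. f t \<in> borel_measurable M" for f
    proof -
      have "(\<lambda>\<omega> t. f t \<omega>) \<in> measurable M path_space"
        using that by (intro measurable_PiM_single') auto
      from integral_distr[OF this g] show ?thesis by (simp add: path_law_def)
    qed
    have "path_law M (\<lambda>t \<omega>. cis (pi/2) * h t \<omega>) = path_law M h"
      using h(1)[unfolded circular_gaussian_process_def, THEN conjunct2, THEN conjunct2] ..
    then have "(LINT \<omega>|M. ?g (\<lambda>t. cis (pi/2) * h t \<omega>)) = (LINT \<omega>|M. ?g (\<lambda>t. h t \<omega>))"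
      using via[of h] via[of "\<lambda>t \<omega>. cis (pi/2) * h t \<omega>"] by simp
    moreover have "?g (\<lambda>t. cis (pi/2) * h t \<omega>) = - ?g (\<lambda>t. h t \<omega>)" for \<omega>
    proof -
      have "(\<Sum>t\<in>F. c t * (cis (pi/2) * h t \<omega>)) = \<i> * (\<Sum>t\<in>F. c t * h t \<omega>)"
        by (simp add: sum_distrib_left mult_ac)
      then show ?thesis by (simp add: power_mult_distrib)
    qed
    ultimately show ?thesis by (simp add: Z_def)
  qed
  have half: "(LINT \<omega>|M. (Re (u * Z \<omega>))\<^sup>2) = (LINT \<omega>|M. (cmod (Z \<omega>))\<^sup>2) / 2" if u: "cmod u = 1" for u
  proof -
    have "(Re (u * z))\<^sup>2 = (cmod z)\<^sup>2 / 2 + Re (u\<^sup>2 * z\<^sup>2) / 2" for z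
    proof -
      have "(cmod z)\<^sup>2 = (Re (u * z))\<^sup>2 + (Im (u * z))\<^sup>2"
        using u cmod_power2[of "u * z"] by (simp only: norm_mult mult_1)
      moreover have "Re (u\<^sup>2 * z\<^sup>2) = (Re (u * z))\<^sup>2 - (Im (u * z))\<^sup>2"
        by (simp add: power_mult_distrib[symmetric] Re_power2)
      ultimately show ?thesis by linarith
    qed
    moreover have "(LINT \<omega>|M. Re (u\<^sup>2 * (Z \<omega>)\<^sup>2)) = 0"
      using Z2 E2 by (subst integral_Re) auto
    ultimately show ?thesis using Z2 by simp
  qed
  have unit: "cmod (Complex s s) = 1" "cmod (Complex s (-s)) = 1"
    by (simp_all add: cmod_def s)
  have "(LINT \<omega>|M. cmod (Z \<omega>) ^ 4) = 2/3 * ((LINT \<omega>|M. (Re (1 * Z \<omega>)) ^ 4) +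
      (LINT \<omega>|M. (Re (\<i> * Z \<omega>)) ^ 4) + (LINT \<omega>|M. (Re (Complex s s * Z \<omega>)) ^ 4) +
      (LINT \<omega>|M. (Re (Complex s (-s) * Z \<omega>)) ^ 4))"
    unfolding avg4 using i4 by (simp only: integral_mult_right_zero
      Bochner_Integration.integral_add Bochner_Integration.integrable_add)
  \<comment> \<open>Four equal terms, each 3 (E |Z|^2 / 2)^2, with the weight 2/3: the constant is
    2/3 * 4 * 3/4 = 2.\<close>
  also have "\<dots> = 2 * (LINT \<omega>|M. (cmod (Z \<omega>))\<^sup>2)\<^sup>2"
    unfolding m4 half[OF norm_one] half[OF norm_ii] half[OF unit(1)] half[OF unit(2)]
    by (simp add: power2_eq_square)
  finally have "(LINT \<omega>|M. cmod (Z \<omega>) ^ 4) = 2 * (LINT \<omega>|M. (cmod (Z \<omega>))\<^sup>2)\<^sup>2" .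
  with Zm Z4 Zi E2 show ?thesis unfolding gaussian_moments_def Z_def by blast
qed

end

lemma cmod_add_power2:
  "(cmod (a + b))\<^sup>2 = (cmod a)\<^sup>2 + (cmod b)\<^sup>2 + 2 * Re (a * cnj b)"
  unfolding cmod_power2 by (simp add: power2_eq_square algebra_simps)

section \<open>Stability of the moment identities under independent sums\<close>

context prob_space
begin

lemma indep_var_moment_products:
  fixes X Y :: "'a \<Rightarrow> complex" and f g :: "complex \<Rightarrow> complex"
  assumes "indep_var borel X borel Y" "f \<in> borel_measurable borel" "g \<in> borel_measurable borel"
    and "integrable M (\<lambda>\<omega>. f (X \<omega>))" "integrable M (\<lambda>\<omega>. g (Y \<omega>))"
  shows "integrable M (\<lambda>\<omega>. f (X \<omega>) * g (Y \<omega>))"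
    and "(LINT \<omega>|M. f (X \<omega>) * g (Y \<omega>)) = (LINT \<omega>|M. f (X \<omega>)) * (LINT \<omega>|M. g (Y \<omega>))"
  using indep_var_compose[OF assms(1,2,3)] assms(4,5)
  by (simp_all add: comp_def indep_var_integrable indep_var_lebesgue_integral)

text \<open>In the expansion of |X + Y|^4 every mixed term except 4 |X|^2 |Y|^2 factors into
  expectations of which one is E X, E Y or E X^2, up to conjugation, and vanishes. With A = E |X|^2
  and B = E |Y|^2 what remains is 2 A^2 + 2 B^2 + 4 A B = 2 (A + B)^2.\<close>

lemma gaussian_moments_add:
  assumes ind: "indep_var borel X borel Y"
    and X: "gaussian_moments M X" and Y: "gaussian_moments M Y"
  shows "gaussian_moments M (\<lambda>\<omega>. X \<omega> + Y \<omega>)"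
proof -
  have [measurable]: "X \<in> borel_measurable M" "Y \<in> borel_measurable M"
    using X Y by (auto simp: gaussian_moments_def)
  note iX = gaussian_moments_integrable[OF X] and iY = gaussian_moments_integrable[OF Y]
  have X4: "integrable M (\<lambda>\<omega>. cmod (X \<omega>) ^ 4)" "integrable M (\<lambda>\<omega>. cmod (Y \<omega>) ^ 4)"
    and m1: "(LINT \<omega>|M. X \<omega>) = 0" "(LINT \<omega>|M. Y \<omega>) = 0"
    and m2: "(LINT \<omega>|M. (X \<omega>)\<^sup>2) = 0" "(LINT \<omega>|M. (Y \<omega>)\<^sup>2) = 0"
    and m4: "(LINT \<omega>|M. cmod (X \<omega>) ^ 4) = 2 * (LINT \<omega>|M. (cmod (X \<omega>))\<^sup>2)\<^sup>2"
      "(LINT \<omega>|M. cmod (Y \<omega>) ^ 4) = 2 * (LINT \<omega>|M. (cmod (Y \<omega>))\<^sup>2)\<^sup>2"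
    using X Y by (auto simp: gaussian_moments_def)
  have i1: "integrable M (\<lambda>\<omega>. X \<omega> * Y \<omega>)" and e1: "(LINT \<omega>|M. X \<omega> * Y \<omega>) = 0"
    using indep_var_moment_products[OF ind, of "\<lambda>z. z" "\<lambda>z. z"] iX iY m1 by auto
  have i2: "integrable M (\<lambda>\<omega>. X \<omega> * cnj (Y \<omega>))" and e2: "(LINT \<omega>|M. X \<omega> * cnj (Y \<omega>)) = 0"
    using indep_var_moment_products[OF ind, of "\<lambda>z. z" cnj] iX iY m1 by auto
  have i3: "integrable M (\<lambda>\<omega>. (X \<omega>)\<^sup>2 * cnj ((Y \<omega>)\<^sup>2))"
    and e3: "(LINT \<omega>|M. (X \<omega>)\<^sup>2 * cnj ((Y \<omega>)\<^sup>2)) = 0"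
    using indep_var_moment_products[OF ind, of "\<lambda>z. z\<^sup>2" "\<lambda>z. cnj (z\<^sup>2)"] iX iY m2 by (auto simp del: complex_cnj_power)
  have cmod3: "cmod (complex_of_real ((cmod z)\<^sup>2) * z) = cmod z ^ 3"
    "cmod (complex_of_real ((cmod z)\<^sup>2) * cnj z) = cmod z ^ 3" for z
    by (simp_all add: norm_mult norm_power power2_eq_square power3_eq_cube)
  have cube: "integrable M (\<lambda>\<omega>. complex_of_real ((cmod (X \<omega>))\<^sup>2) * X \<omega>)"
    by (rule integrable_of_power4_bound[OF _ X4(1)], measurable) (simp only: cmod3 le_one_plus_power4 norm_ge_zero)
  have cube': "integrable M (\<lambda>\<omega>. complex_of_real ((cmod (Y \<omega>))\<^sup>2) * cnj (Y \<omega>))"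
    by (rule integrable_of_power4_bound[OF _ X4(2)], measurable) (simp only: cmod3 le_one_plus_power4 norm_ge_zero)
  have i4: "integrable M (\<lambda>\<omega>. complex_of_real ((cmod (X \<omega>))\<^sup>2) * X \<omega> * cnj (Y \<omega>))"
    and e4: "(LINT \<omega>|M. complex_of_real ((cmod (X \<omega>))\<^sup>2) * X \<omega> * cnj (Y \<omega>)) = 0"
    using indep_var_moment_products[OF ind, of "\<lambda>z. complex_of_real ((cmod z)\<^sup>2) * z" cnj]
      cube iY m1 by auto
  have i5: "integrable M (\<lambda>\<omega>. X \<omega> * (complex_of_real ((cmod (Y \<omega>))\<^sup>2) * cnj (Y \<omega>)))"
    and e5: "(LINT \<omega>|M. X \<omega> * (complex_of_real ((cmod (Y \<omega>))\<^sup>2) * cnj (Y \<omega>))) = 0"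
    using indep_var_moment_products[OF ind, of "\<lambda>z. z" "\<lambda>z. complex_of_real ((cmod z)\<^sup>2) * cnj z"]
      cube' iX m1 by auto
  have indR: "indep_var borel (\<lambda>\<omega>. (cmod (X \<omega>))\<^sup>2) borel (\<lambda>\<omega>. (cmod (Y \<omega>))\<^sup>2)"
    using indep_var_compose[OF ind, of "\<lambda>z. (cmod z)\<^sup>2" borel "\<lambda>z. (cmod z)\<^sup>2" borel]
    by (simp add: comp_def)
  have i6: "integrable M (\<lambda>\<omega>. (cmod (X \<omega>))\<^sup>2 * (cmod (Y \<omega>))\<^sup>2)"
    and e6: "(LINT \<omega>|M. (cmod (X \<omega>))\<^sup>2 * (cmod (Y \<omega>))\<^sup>2) =
      (LINT \<omega>|M. (cmod (X \<omega>))\<^sup>2) * (LINT \<omega>|M. (cmod (Y \<omega>))\<^sup>2)"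
    using indep_var_integrable[OF indR] indep_var_lebesgue_integral[OF indR] iX iY by auto
  \<comment> \<open>This splits the squared cross term (2 Re q)^2 into 2 |q|^2, which brings the
    coefficient of |a|^2 |b|^2 from 2 to 4, and 2 Re (q^2), whose expectation vanishes.\<close>
  have Re_sq: "2 * (Re z)\<^sup>2 = (cmod z)\<^sup>2 + Re (z\<^sup>2)" for z
    by (simp add: cmod_power2 Re_power2)
  have four: "r ^ 4 = (r\<^sup>2)\<^sup>2" for r :: real by (simp add: power_mult[symmetric])
  have ex4: "cmod (a + b) ^ 4 = cmod a ^ 4 + cmod b ^ 4 + 4 * ((cmod a)\<^sup>2 * (cmod b)\<^sup>2) +
      2 * Re (a\<^sup>2 * cnj (b\<^sup>2)) + 4 * Re (complex_of_real ((cmod a)\<^sup>2) * a * cnj b) +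
      4 * Re (a * (complex_of_real ((cmod b)\<^sup>2) * cnj b))" for a b
  proof -
    define q where "q = a * cnj b"
    have 1: "a\<^sup>2 * cnj (b\<^sup>2) = q\<^sup>2" "(cmod q)\<^sup>2 = (cmod a)\<^sup>2 * (cmod b)\<^sup>2"
      by (simp_all add: q_def power_mult_distrib norm_mult)
    have 2: "Re (complex_of_real ((cmod a)\<^sup>2) * a * cnj b) = (cmod a)\<^sup>2 * Re q"
      "Re (a * (complex_of_real ((cmod b)\<^sup>2) * cnj b)) = (cmod b)\<^sup>2 * Re q"
      by (simp_all add: q_def mult.assoc mult.left_commute[of a] del: of_real_power)
    have "cmod (a + b) ^ 4 = ((cmod a)\<^sup>2 + (cmod b)\<^sup>2 + 2 * Re q)\<^sup>2"
      by (simp only: four cmod_add_power2 q_def)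
    also have "\<dots> = ((cmod a)\<^sup>2)\<^sup>2 + ((cmod b)\<^sup>2)\<^sup>2 + 2 * ((cmod a)\<^sup>2 * (cmod b)\<^sup>2)
       + 2 * (2 * (Re q)\<^sup>2) + 4 * ((cmod a)\<^sup>2 * Re q) + 4 * ((cmod b)\<^sup>2 * Re q)"
      by (simp add: power2_eq_square algebra_simps)
    also have "\<dots> = cmod a ^ 4 + cmod b ^ 4 + 4 * ((cmod a)\<^sup>2 * (cmod b)\<^sup>2) + 2 * Re (q\<^sup>2)
       + 4 * ((cmod a)\<^sup>2 * Re q) + 4 * ((cmod b)\<^sup>2 * Re q)"
      unfolding Re_sq 1 four by (simp only: ring_distribs mult_2)
    finally show ?thesis unfolding 1 2 by simp
  qed
  have E2: "(LINT \<omega>|M. (cmod (X \<omega> + Y \<omega>))\<^sup>2) = (LINT \<omega>|M. (cmod (X \<omega>))\<^sup>2) + (LINT \<omega>|M. (cmod (Y \<omega>))\<^sup>2)"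
    unfolding cmod_add_power2 using iX iY i2 e2 by (simp add: integral_Re del: Re_complex_of_real times_complex.sel)
  note intg = X4 i6 i3 i4 i5
  have E4: "(LINT \<omega>|M. cmod (X \<omega> + Y \<omega>) ^ 4) = (LINT \<omega>|M. cmod (X \<omega>) ^ 4) + (LINT \<omega>|M. cmod (Y \<omega>) ^ 4)
     + 4 * ((LINT \<omega>|M. (cmod (X \<omega>))\<^sup>2) * (LINT \<omega>|M. (cmod (Y \<omega>))\<^sup>2))"
    and I4: "integrable M (\<lambda>\<omega>. cmod (X \<omega> + Y \<omega>) ^ 4)"
    unfolding ex4 using intg e3 e4 e5 e6
    by (simp_all add: integral_Re del: times_complex.sel Re_divide_numeral complex_cnj_power of_real_power)
  have "(LINT \<omega>|M. X \<omega> + Y \<omega>) = 0" using iX iY m1 by simp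
  moreover have "(LINT \<omega>|M. (X \<omega> + Y \<omega>)\<^sup>2) = 0"
  proof -
    have "(LINT \<omega>|M. (X \<omega> + Y \<omega>)\<^sup>2) = (LINT \<omega>|M. (X \<omega>)\<^sup>2 + (Y \<omega>)\<^sup>2 + 2 * (X \<omega> * Y \<omega>))"
      by (simp add: power2_sum mult.assoc)
    then show ?thesis using iX iY i1 e1 m2 by simp
  qed
  moreover have "(LINT \<omega>|M. cmod (X \<omega> + Y \<omega>) ^ 4) = 2 * (LINT \<omega>|M. (cmod (X \<omega> + Y \<omega>))\<^sup>2)\<^sup>2"
    unfolding E4 E2 m4 by (simp add: power2_eq_square algebra_simps)
  ultimately show ?thesis using I4 unfolding gaussian_moments_def by simp
qed

lemma gaussian_moments_zero: "gaussian_moments M (\<lambda>_. 0)"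
  by (simp add: gaussian_moments_def)

lemma gaussian_moments_scale:
  assumes "gaussian_moments M Z"
  shows "gaussian_moments M (\<lambda>\<omega>. u * Z \<omega>)"
  using assms unfolding gaussian_moments_def
  by (auto simp: norm_mult power_mult_distrib)

lemma indep_vars_sum_complex:
  fixes X :: "'i \<Rightarrow> 'a \<Rightarrow> complex"
  assumes I: "finite I" "i \<notin> I" and indep: "indep_vars (\<lambda>_. borel) X (insert i I)"
  shows "indep_var borel (X i) borel (\<lambda>\<omega>. \<Sum>i\<in>I. X i \<omega>)"
proof -
  have "indep_var
    borel ((\<lambda>f. f i) \<circ> (\<lambda>\<omega>. restrict (\<lambda>i. X i \<omega>) {i}))
    borel ((\<lambda>f. \<Sum>i\<in>I. f i) \<circ> (\<lambda>\<omega>. restrict (\<lambda>i. X i \<omega>) I))"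
    using I by (intro indep_var_compose[OF indep_var_restrict[OF indep]]) auto
  then show ?thesis by (simp add: comp_def cong: sum.cong)
qed

lemma gaussian_moments_sum:
  fixes X :: "'i \<Rightarrow> 'a \<Rightarrow> complex"
  assumes "finite I" "indep_vars (\<lambda>_. borel) X I" "\<And>i. i \<in> I \<Longrightarrow> gaussian_moments M (X i)"
  shows "gaussian_moments M (\<lambda>\<omega>. \<Sum>i\<in>I. X i \<omega>)"
  using assms
proof (induction I rule: finite_induct)
  case empty
  then show ?case by (simp add: gaussian_moments_zero)
next
  case (insert i I)
  have "gaussian_moments M (\<lambda>\<omega>. X i \<omega> + (\<Sum>i\<in>I. X i \<omega>))"
    using insert by (intro gaussian_moments_add indep_vars_sum_complex)
      (auto intro: indep_vars_subset)
  with insert show ?case by simp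
qed

end

section \<open>Wick's formula on a family closed under linear combinations, as polarisation
  requires\<close>

locale gaussian_moment_space = prob_space +
  fixes V :: "('a \<Rightarrow> complex) set"
  assumes add_mem: "\<And>f g. f \<in> V \<Longrightarrow> g \<in> V \<Longrightarrow> (\<lambda>\<omega>. f \<omega> + g \<omega>) \<in> V"
    and scale_mem: "\<And>f u. f \<in> V \<Longrightarrow> (\<lambda>\<omega>. u * f \<omega>) \<in> V"
    and moments: "\<And>f. f \<in> V \<Longrightarrow> gaussian_moments M f"
begin

abbreviation cov :: "('a \<Rightarrow> complex) \<Rightarrow> ('a \<Rightarrow> complex) \<Rightarrow> complex" where
  "cov f g \<equiv> (LINT \<omega>|M. f \<omega> * cnj (g \<omega>))"

lemma int2: "f \<in> V \<Longrightarrow> g \<in> V \<Longrightarrow> integrable M (\<lambda>\<omega>. f \<omega> * cnj (g \<omega>))"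
  by (intro gaussian_moments_integrable_mult_cnj moments)

lemma int4: "\<lbrakk>a \<in> V; b \<in> V; c \<in> V; d \<in> V\<rbrakk> \<Longrightarrow>
    integrable M (\<lambda>\<omega>. a \<omega> * b \<omega> * cnj (c \<omega>) * cnj (d \<omega>))"
  by (intro gaussian_moments_integrable_prod4 moments)

lemma cov_add_left: "\<lbrakk>f \<in> V; f' \<in> V; g \<in> V\<rbrakk> \<Longrightarrow> cov (\<lambda>\<omega>. f \<omega> + f' \<omega>) g = cov f g + cov f' g"
  using int2 by (simp add: distrib_right)

lemma cov_add_right: "\<lbrakk>f \<in> V; g \<in> V; g' \<in> V\<rbrakk> \<Longrightarrow> cov f (\<lambda>\<omega>. g \<omega> + g' \<omega>) = cov f g + cov f g'"
  using int2 by (simp add: distrib_left)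

text \<open>Polarisation in the second argument: with \<open>q = a * cnj c\<close>, the fourth powers of
  \<open>a \<plusminus> c\<close> and \<open>a \<plusminus> \<i> c\<close> combine to \<open>8 Re (q\<^sup>2)\<close>.\<close>

lemma Re_wick_square:
  assumes a: "a \<in> V" and c: "c \<in> V"
  shows "Re (LINT \<omega>|M. (a \<omega> * cnj (c \<omega>))\<^sup>2) = 2 * Re ((cov a c)\<^sup>2)"
proof -
  have mem: "(\<lambda>\<omega>. a \<omega> + u * c \<omega>) \<in> V" for u
    using add_mem[OF a scale_mem[OF c]] .
  have i2: "integrable M (\<lambda>\<omega>. a \<omega> * cnj (c \<omega>))" using a c by (rule int2)
  have isq: "integrable M (\<lambda>\<omega>. (a \<omega> * cnj (c \<omega>))\<^sup>2)"
    using int4[OF a a c c] by (simp add: power2_eq_square mult_ac)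
  have ia: "integrable M (\<lambda>\<omega>. (cmod (a \<omega>))\<^sup>2)" and ic: "integrable M (\<lambda>\<omega>. (cmod (c \<omega>))\<^sup>2)"
    using a c by (auto intro: gaussian_moments_integrable moments)
  define P where "P = (LINT \<omega>|M. (cmod (a \<omega>))\<^sup>2 + (cmod (c \<omega>))\<^sup>2)"
  have ex: "(cmod (x + u * y))\<^sup>2 = (cmod x)\<^sup>2 + (cmod y)\<^sup>2 + 2 * Re (cnj u * (x * cnj y))"
    if "cmod u = 1" for x y u
  proof -
    show ?thesis using that by (simp add: cmod_add_power2 norm_mult mult_ac)
  qed
  have E2: "(LINT \<omega>|M. (cmod (a \<omega> + u * c \<omega>))\<^sup>2) = P + 2 * Re (cnj u * cov a c)" if "cmod u = 1" for u
    unfolding ex[OF that] P_def using ia ic i2 by (simp add: integral_Re del: times_complex.sel)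
  have i4: "integrable M (\<lambda>\<omega>. cmod (a \<omega> + u * c \<omega>) ^ 4)"
    and E4: "(LINT \<omega>|M. cmod (a \<omega> + u * c \<omega>) ^ 4) = 2 * (LINT \<omega>|M. (cmod (a \<omega> + u * c \<omega>))\<^sup>2)\<^sup>2" for u
    using moments[OF mem[of u]] by (auto simp: gaussian_moments_def)
  \<comment> \<open>This identity is used twice: pointwise under the integral, with \<open>p\<close>
    the sum of the squared moduli, and for the second moments, with \<open>p = P\<close> and
    \<open>q = cov a c\<close>. The fourth moment identity links the two uses and contributes the
    factor 2.\<close>
  have pol: "(p + 2 * Re (cnj 1 * q))\<^sup>2 + (p + 2 * Re (cnj (- 1) * q))\<^sup>2
      - (p + 2 * Re (cnj \<i> * q))\<^sup>2 - (p + 2 * Re (cnj (- \<i>) * q))\<^sup>2 = 8 * Re (q\<^sup>2)" for p q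
    by (simp add: Re_power2 power2_eq_square algebra_simps)
  have four: "r ^ 4 = (r\<^sup>2)\<^sup>2" for r :: real by (simp add: power_mult[symmetric])
  have "8 * Re ((x * cnj y)\<^sup>2) = cmod (x + 1 * y) ^ 4 + cmod (x + (- 1) * y) ^ 4
      - cmod (x + \<i> * y) ^ 4 - cmod (x + (- \<i>) * y) ^ 4" for x y
    unfolding four by (subst (1 2 3 4) ex) (simp_all only: pol norm_one norm_minus_cancel norm_ii)
  then have "8 * Re (LINT \<omega>|M. (a \<omega> * cnj (c \<omega>))\<^sup>2) = 2 * (8 * Re ((cov a c)\<^sup>2))"
  proof -
    assume *: "\<And>x y. 8 * Re ((x * cnj y)\<^sup>2) = cmod (x + 1 * y) ^ 4 + cmod (x + (- 1) * y) ^ 4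
      - cmod (x + \<i> * y) ^ 4 - cmod (x + (- \<i>) * y) ^ 4"
    have "8 * Re (LINT \<omega>|M. (a \<omega> * cnj (c \<omega>))\<^sup>2) = (LINT \<omega>|M. 8 * Re ((a \<omega> * cnj (c \<omega>))\<^sup>2))"
      using isq by (simp only: integral_mult_right_zero integral_Re)
    also have "\<dots> = (LINT \<omega>|M. cmod (a \<omega> + 1 * c \<omega>) ^ 4) + (LINT \<omega>|M. cmod (a \<omega> + (- 1) * c \<omega>) ^ 4)
      - (LINT \<omega>|M. cmod (a \<omega> + \<i> * c \<omega>) ^ 4) - (LINT \<omega>|M. cmod (a \<omega> + (- \<i>) * c \<omega>) ^ 4)"
      unfolding * using i4[of 1] i4[of "-1"] i4[of \<i>] i4[of "-\<i>"]
      by (simp only: Bochner_Integration.integral_add Bochner_Integration.integral_diff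
          Bochner_Integration.integrable_add Bochner_Integration.integrable_diff)
    also have "\<dots> = 2 * (8 * Re ((cov a c)\<^sup>2))"
      unfolding E4 pol[symmetric, of "cov a c" P]
      by (subst (1 2 3 4) E2) (simp_all only: norm_one norm_minus_cancel norm_ii ring_distribs)
    finally show ?thesis .
  qed
  then show ?thesis by simp
qed

text \<open>The imaginary part follows from the real part: replacing \<open>c\<close> by
  \<open>u * c\<close> with \<open>u = cis (pi / 4)\<close> multiplies both sides by -i, and Re (-i
  z) = Im z.\<close>

lemma wick_square:
  assumes a: "a \<in> V" and c: "c \<in> V"
  shows "(LINT \<omega>|M. (a \<omega> * cnj (c \<omega>))\<^sup>2) = 2 * (cov a c)\<^sup>2"
proof (rule complex_eqI)
  show "Re (LINT \<omega>|M. (a \<omega> * cnj (c \<omega>))\<^sup>2) = Re (2 * (cov a c)\<^sup>2)"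
    using Re_wick_square[OF a c] by simp
  define u where "u = cis (pi / 4)"
  have u: "(cnj u)\<^sup>2 = - \<i>"
  proof -
    have "u\<^sup>2 = \<i>" using Complex.DeMoivre[of "pi / 4" 2] by (simp add: u_def)
    then show ?thesis by (metis complex_cnj_power complex_cnj_i)
  qed
  have "Re (LINT \<omega>|M. (a \<omega> * cnj (u * c \<omega>))\<^sup>2) = 2 * Re ((cov a (\<lambda>\<omega>. u * c \<omega>))\<^sup>2)"
    using a scale_mem[OF c] by (rule Re_wick_square)
  moreover have "(a \<omega> * cnj (u * c \<omega>))\<^sup>2 = - \<i> * (a \<omega> * cnj (c \<omega>))\<^sup>2" for \<omega>
    by (simp add: power_mult_distrib u)
  moreover have "(cov a (\<lambda>\<omega>. u * c \<omega>))\<^sup>2 = - \<i> * (cov a c)\<^sup>2"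
  proof -
    have "cov a (\<lambda>\<omega>. u * c \<omega>) = cnj u * cov a c"
      by (simp add: mult.left_commute)
    then show ?thesis by (simp add: power_mult_distrib u)
  qed
  ultimately show "Im (LINT \<omega>|M. (a \<omega> * cnj (c \<omega>))\<^sup>2) = Im (2 * (cov a c)\<^sup>2)"
    by simp
qed

text \<open>First polarisation: \<open>wick_square\<close> for \<open>a + b\<close>, minus the same
  for \<open>a\<close> and for \<open>b\<close>, leaves twice the mixed term.\<close>

lemma wick_right_square:
  assumes a: "a \<in> V" and b: "b \<in> V" and c: "c \<in> V"
  shows "(LINT \<omega>|M. a \<omega> * b \<omega> * cnj (c \<omega>) * cnj (c \<omega>)) = 2 * cov a c * cov b c"
proof -
  have "((x + y) * cnj z)\<^sup>2 = (x * cnj z)\<^sup>2 + (y * cnj z)\<^sup>2 + 2 * (x * y * cnj z * cnj z)" for x y z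
    by (simp add: power2_eq_square algebra_simps)
  moreover have "integrable M (\<lambda>\<omega>. (a \<omega> * cnj (c \<omega>))\<^sup>2)" "integrable M (\<lambda>\<omega>. (b \<omega> * cnj (c \<omega>))\<^sup>2)"
    using int4[OF a a c c] int4[OF b b c c] by (simp_all add: power2_eq_square mult_ac)
  ultimately have "(LINT \<omega>|M. ((a \<omega> + b \<omega>) * cnj (c \<omega>))\<^sup>2) =
     (LINT \<omega>|M. (a \<omega> * cnj (c \<omega>))\<^sup>2) + (LINT \<omega>|M. (b \<omega> * cnj (c \<omega>))\<^sup>2) +
     2 * (LINT \<omega>|M. a \<omega> * b \<omega> * cnj (c \<omega>) * cnj (c \<omega>))"
    using int4[OF a b c c] by simp
  then show ?thesis
    using wick_square[OF a c] wick_square[OF b c] wick_square[OF add_mem[OF a b] c]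
      cov_add_left[OF a b c]
    by (simp add: power2_eq_square algebra_simps)
qed

text \<open>Second polarisation, now in the conjugated slot, with \<open>c + d\<close>. The two
  pairings are the mixed terms of a product of two sums.\<close>

lemma wick:
  assumes a: "a \<in> V" and b: "b \<in> V" and c: "c \<in> V" and d: "d \<in> V"
  shows "(LINT \<omega>|M. a \<omega> * b \<omega> * cnj (c \<omega>) * cnj (d \<omega>)) = cov a c * cov b d + cov a d * cov b c"
proof -
  have "x * y * cnj (z + w) * cnj (z + w) = x * y * cnj z * cnj z + x * y * cnj w * cnj w
      + 2 * (x * y * cnj z * cnj w)" for x y z w
    by (simp add: algebra_simps)
  then have "(LINT \<omega>|M. a \<omega> * b \<omega> * cnj (c \<omega> + d \<omega>) * cnj (c \<omega> + d \<omega>)) =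
     (LINT \<omega>|M. a \<omega> * b \<omega> * cnj (c \<omega>) * cnj (c \<omega>)) + (LINT \<omega>|M. a \<omega> * b \<omega> * cnj (d \<omega>) * cnj (d \<omega>)) +
     2 * (LINT \<omega>|M. a \<omega> * b \<omega> * cnj (c \<omega>) * cnj (d \<omega>))"
    using int4[OF a b c c] int4[OF a b d d] int4[OF a b c d] by simp
  then have "2 * (cov a c + cov a d) * (cov b c + cov b d) = 2 * cov a c * cov b c +
      2 * cov a d * cov b d + 2 * (LINT \<omega>|M. a \<omega> * b \<omega> * cnj (c \<omega>) * cnj (d \<omega>))"
    unfolding wick_right_square[OF a b c] wick_right_square[OF a b d]
      wick_right_square[OF a b add_mem[OF c d]] cov_add_right[OF a c d] cov_add_right[OF b c d] .
  moreover have "I = p * s + q * r" if "2 * (p + q) * (r + s) = 2 * p * r + 2 * q * s + 2 * I"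
    for p q r s I :: complex
  proof -
    have "2 * I = 2 * (p * s + q * r)" using that by (simp add: algebra_simps)
    then show ?thesis by (simp only: mult_cancel_left) simp
  qed
  ultimately show ?thesis by blast
qed

end

section \<open>Moments of the law CN(0, v), computed in real and imaginary parts\<close>

lemma lborel_complex_eq: "(lborel :: complex measure) = distr (lborel \<Otimes>\<^sub>M lborel) borel (\<lambda>p. Complex (fst p) (snd p))"
proof (rule lborel_eqI)
  have [measurable]: "(\<lambda>p. Complex (fst p) (snd p)) \<in> borel_measurable (borel \<Otimes>\<^sub>M borel)"
    unfolding Complex_eq by measurable
  fix l u :: complex
  assume le: "\<And>b. b \<in> Basis \<Longrightarrow> l \<bullet> b \<le> u \<bullet> b"
  have le': "Re l \<le> Re u" "Im l \<le> Im u" 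
    using le[of 1] le[of \<i>] by (auto simp: Basis_complex_def)
  have "(\<lambda>p. Complex (fst p) (snd p)) -` box l u \<inter> space (lborel \<Otimes>\<^sub>M lborel) = {Re l <..< Re u} \<times> {Im l <..< Im u}"
    by (auto simp: box_def Basis_complex_def space_pair_measure)
  then show "emeasure (distr (lborel \<Otimes>\<^sub>M lborel) borel (\<lambda>p. Complex (fst p) (snd p))) (box l u) =
      ennreal (\<Prod>b\<in>Basis. (u - l) \<bullet> b)"
    using le' by (simp add: emeasure_distr lborel.emeasure_pair_measure_Times Basis_complex_def ennreal_mult)
qed simp

lemma has_bochner_integral_lborel_times:
  fixes f g :: "real \<Rightarrow> real"
  assumes f: "has_bochner_integral lborel f a" and g: "has_bochner_integral lborel g b"
  shows "has_bochner_integral (lborel \<Otimes>\<^sub>M lborel) (\<lambda>p. f (fst p) * g (snd p)) (a * b)"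
proof -
  have i: "integrable lborel f" "integrable lborel g" and e: "integral\<^sup>L lborel f = a" "integral\<^sup>L lborel g = b"
    using f g by (auto simp: has_bochner_integral_iff)
  have [measurable]: "f \<in> borel_measurable borel" "g \<in> borel_measurable borel"
    using i by (auto dest: borel_measurable_integrable)
  have int: "integrable (lborel \<Otimes>\<^sub>M lborel) (\<lambda>p. f (fst p) * g (snd p))"
    by (rule lborel_pair.Fubini_integrable) (use i in \<open>auto simp: abs_mult\<close>)
  have "(LINT p|(lborel \<Otimes>\<^sub>M lborel). f (fst p) * g (snd p)) = (LINT x|lborel. LINT y|lborel. f x * g y)"
    using lborel_pair.integral_fst'[OF int] by simp
  also have "\<dots> = a * b" using i e by simp
  finally show ?thesis using int by (simp add: has_bochner_integral_iff)
qed

text \<open>In Cartesian coordinates the density of CN(0, v) is the product of two centred normal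
  densities of variance v/2, so that integrals reduce to real normal moments.\<close>

lemma has_bochner_integral_cn_law:
  fixes f :: "complex \<Rightarrow> real"
  assumes v: "v > 0" and f: "f \<in> borel_measurable borel"
    and p: "has_bochner_integral (lborel \<Otimes>\<^sub>M lborel)
      (\<lambda>p. normal_density 0 (sqrt (v / 2)) (fst p) * normal_density 0 (sqrt (v / 2)) (snd p) * f (Complex (fst p) (snd p))) I"
  shows "has_bochner_integral (cn_law v) f I"
proof -
  note f[measurable]
  have [measurable]: "(\<lambda>p. Complex (fst p) (snd p)) \<in> borel_measurable (borel \<Otimes>\<^sub>M borel)"
    unfolding Complex_eq by measurable
  have dens: "exp (- (cmod (Complex x y))\<^sup>2 / v) / (pi * v) =
      normal_density 0 (sqrt (v / 2)) x * normal_density 0 (sqrt (v / 2)) y" for x y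
    using v by (simp add: normal_density_def cmod_power2 mult_exp_exp add_divide_distrib diff_divide_distrib)
  have "has_bochner_integral (distr (lborel \<Otimes>\<^sub>M lborel) borel (\<lambda>p. Complex (fst p) (snd p)))
     (\<lambda>z. (exp (- (cmod z)\<^sup>2 / v) / (pi * v)) *\<^sub>R f z) I"
    using p by (intro has_bochner_integral_distr, measurable) (simp only: dens real_scaleR_def)
  then have "has_bochner_integral lborel (\<lambda>z. (exp (- (cmod z)\<^sup>2 / v) / (pi * v)) *\<^sub>R f z) I"
    by (simp only: lborel_complex_eq)
  then have "has_bochner_integral (density lborel (\<lambda>z. ennreal (exp (- (cmod z)\<^sup>2 / v) / (pi * v)))) f I"
    using v by (intro has_bochner_integral_density) auto
  then show ?thesis using v by (simp add: cn_law_def)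
qed

lemma cn_law_monomial:
  assumes v: "v > 0"
    and i: "has_bochner_integral lborel (\<lambda>x. normal_density 0 (sqrt (v / 2)) x * x ^ i) a"
    and j: "has_bochner_integral lborel (\<lambda>x. normal_density 0 (sqrt (v / 2)) x * x ^ j) b"
  shows "has_bochner_integral (cn_law v) (\<lambda>z. Re z ^ i * Im z ^ j) (a * b)"
  by (rule has_bochner_integral_cn_law[OF v])
     (use has_bochner_integral_lborel_times[OF i j] in \<open>simp_all add: mult_ac\<close>)

lemma cn_law_moments:
  assumes v: "v > 0"
  shows "has_bochner_integral (cn_law v) (\<lambda>z. z) 0"
    "has_bochner_integral (cn_law v) (\<lambda>z. z\<^sup>2) 0"
    "has_bochner_integral (cn_law v) (\<lambda>z. (cmod z)\<^sup>2) v"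
    "has_bochner_integral (cn_law v) (\<lambda>z. cmod z ^ 4) (2 * v\<^sup>2)"
proof -
  let ?n = "normal_density 0 (sqrt (v / 2))"
  have s: "0 < sqrt (v / 2)" and s2: "(sqrt (v / 2))\<^sup>2 = v / 2" using v by simp_all
  have m0: "has_bochner_integral lborel (\<lambda>x. ?n x * x ^ 0) 1"
    using normal_moment_even[OF s, of 0 0] by simp
  have m1: "has_bochner_integral lborel (\<lambda>x. ?n x * x ^ 1) 0"
    using normal_moment_odd[OF s, of 0 0] by simp
  have m2: "has_bochner_integral lborel (\<lambda>x. ?n x * x ^ 2) (v / 2)"
    using normal_moment_even[OF s, of 0 1] v by (simp add: fact_numeral)
  have m4: "has_bochner_integral lborel (\<lambda>x. ?n x * x ^ 4) (3 * (v / 2)\<^sup>2)"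
    using normal_moment_even[OF s, of 0 2] v by (simp add: fact_numeral power_divide)
  note mono = cn_law_monomial[OF v]
  have cx: "has_bochner_integral (cn_law v) f (Complex a b)"
    if "has_bochner_integral (cn_law v) (\<lambda>z. Re (f z)) a" "has_bochner_integral (cn_law v) (\<lambda>z. Im (f z)) b"
    for f a b
    using has_bochner_integral_add[OF has_bochner_integral_of_real[OF that(1)]
        has_bochner_integral_mult_right[OF has_bochner_integral_of_real[OF that(2)], of \<i>]]
    by (simp add: complex_eq[symmetric] Complex_eq)
  show "has_bochner_integral (cn_law v) (\<lambda>z. z) 0"
    using cx[of "\<lambda>z. z" 0 0] mono[OF m1 m0] mono[OF m0 m1] by (simp add: Complex_eq)
  show "has_bochner_integral (cn_law v) (\<lambda>z. z\<^sup>2) 0"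
    using cx[of "\<lambda>z. z\<^sup>2" 0 0] has_bochner_integral_diff[OF mono[OF m2 m0] mono[OF m0 m2]]
      has_bochner_integral_mult_right[OF mono[OF m1 m1], of 2]
    by (simp add: Re_power2 Im_power2 mult.assoc Complex_eq)
  show "has_bochner_integral (cn_law v) (\<lambda>z. (cmod z)\<^sup>2) v"
    using has_bochner_integral_add[OF mono[OF m2 m0] mono[OF m0 m2]] by (simp add: cmod_power2)
  have four: "cmod z ^ 4 = Re z ^ 4 * Im z ^ 0 + Re z ^ 0 * Im z ^ 4 + 2 * (Re z ^ 2 * Im z ^ 2)" for z
  proof -
    have "cmod z ^ 4 = ((Re z)\<^sup>2 + (Im z)\<^sup>2)\<^sup>2"
      using power_mult[of "cmod z" 2 2] by (simp add: cmod_power2)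
    then show ?thesis by (simp add: power2_eq_square power4_eq_xxxx algebra_simps)
  qed
  \<comment> \<open>The parts contribute 3 (v/2)^2 each and the mixed term 2 (v/2)^2, in total 2
    v^2.\<close>
  have "has_bochner_integral (cn_law v) (\<lambda>z. cmod z ^ 4)
      (3 * (v / 2)\<^sup>2 * 1 + 1 * (3 * (v / 2)\<^sup>2) + 2 * (v / 2 * (v / 2)))"
    unfolding four
    by (intro has_bochner_integral_add has_bochner_integral_mult_right mono m4 m0 m2)
  then show "has_bochner_integral (cn_law v) (\<lambda>z. cmod z ^ 4) (2 * v\<^sup>2)"
    by (simp add: power2_eq_square)
qed

lemma has_bochner_integral_distr_iff:
  fixes f :: "'b \<Rightarrow> 'c :: {banach, second_countable_topology}"
  assumes "f \<in> borel_measurable N" "g \<in> measurable M N"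
  shows "has_bochner_integral (distr M N g) f I \<longleftrightarrow> has_bochner_integral M (\<lambda>x. f (g x)) I"
  using assms by (simp add: has_bochner_integral_iff integrable_distr_eq integral_distr)

context prob_space
begin

lemma cn_distributed_moments:
  assumes Z: "cn_distributed M Z v" and "v \<ge> 0"
  shows "gaussian_moments M Z" and "(LINT \<omega>|M. (cmod (Z \<omega>))\<^sup>2) = v"
proof -
  have [measurable]: "Z \<in> borel_measurable M" and law: "distr M borel Z = cn_law v"
    using Z by (auto simp: cn_distributed_def)
  have "gaussian_moments M Z \<and> (LINT \<omega>|M. (cmod (Z \<omega>))\<^sup>2) = v"
  proof (cases "v = 0")
    case True
    have "AE z in distr M borel Z. z = 0"
    proof -
    have "cn_law v = return borel 0" using True by (simp add: cn_law_def)
    then show ?thesis unfolding law by (simp only:) (subst AE_return, auto)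
  qed
    then have ae: "AE \<omega> in M. Z \<omega> = 0" by (simp add: AE_distr_iff)
    have "integrable M (\<lambda>\<omega>. cmod (Z \<omega>) ^ 4) = integrable M (\<lambda>\<omega>. 0::real)"
      by (rule integrable_cong_AE) (use ae in auto)
    moreover have "(LINT \<omega>|M. cmod (Z \<omega>) ^ 4) = (LINT \<omega>|M. 0)"
      by (rule integral_cong_AE) (use ae in auto)
    moreover have "(LINT \<omega>|M. (cmod (Z \<omega>))\<^sup>2) = (LINT \<omega>|M. 0)"
      by (rule integral_cong_AE) (use ae in auto)
    moreover have "(LINT \<omega>|M. Z \<omega>) = (LINT \<omega>|M. 0)"
      by (rule integral_cong_AE) (use ae in auto)
    moreover have "(LINT \<omega>|M. (Z \<omega>)\<^sup>2) = (LINT \<omega>|M. 0)"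
      by (rule integral_cong_AE) (use ae in auto)
    ultimately show ?thesis using True by (simp add: gaussian_moments_def)
  next
    case False
    with \<open>v \<ge> 0\<close> have v: "v > 0" by simp
    have "has_bochner_integral M (\<lambda>\<omega>. Z \<omega>) 0" "has_bochner_integral M (\<lambda>\<omega>. (Z \<omega>)\<^sup>2) 0"
      "has_bochner_integral M (\<lambda>\<omega>. (cmod (Z \<omega>))\<^sup>2) v" "has_bochner_integral M (\<lambda>\<omega>. cmod (Z \<omega>) ^ 4) (2 * v\<^sup>2)"
      by (rule has_bochner_integral_distr_iff[THEN iffD1, of _ borel Z M],
          simp, simp, simp add: law cn_law_moments v)+
    then show ?thesis
      by (simp add: gaussian_moments_def has_bochner_integral_iff)
  qed
  then show "gaussian_moments M Z" and "(LINT \<omega>|M. (cmod (Z \<omega>))\<^sup>2) = v" by auto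
qed

end

section \<open>The autoregressive model\<close>

context prob_space
begin

lemma second_moment_add_orthogonal:
  fixes X Y :: "'a \<Rightarrow> complex"
  assumes "integrable M (\<lambda>\<omega>. (cmod (X \<omega>))\<^sup>2)" "integrable M (\<lambda>\<omega>. (cmod (Y \<omega>))\<^sup>2)"
    and "integrable M (\<lambda>\<omega>. X \<omega> * cnj (Y \<omega>))" "(LINT \<omega>|M. X \<omega> * cnj (Y \<omega>)) = 0"
  shows "(LINT \<omega>|M. (cmod (X \<omega> + Y \<omega>))\<^sup>2) = (LINT \<omega>|M. (cmod (X \<omega>))\<^sup>2) + (LINT \<omega>|M. (cmod (Y \<omega>))\<^sup>2)"
  unfolding cmod_add_power2 using assms by (simp add: integral_Re del: times_complex.sel)

lemma indep_vars_pair_complex: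
  fixes X :: "'i \<Rightarrow> 'a \<Rightarrow> complex"
  assumes "indep_vars (\<lambda>_. borel) X I" "i \<in> I" "j \<in> I" "i \<noteq> j"
  shows "indep_var borel (X i) borel (X j)"
proof -
  have "indep_vars (\<lambda>_. borel) X (insert i {j})"
    using assms(1) by (rule indep_vars_subset) (use assms in auto)
  from indep_vars_sum_complex[OF _ _ this] assms(4) show ?thesis by simp
qed

lemma indep_var_cov_0:
  fixes X Y :: "'a \<Rightarrow> complex"
  assumes "indep_var borel X borel Y" "integrable M X" "integrable M Y"
  shows "(LINT \<omega>|M. X \<omega> * cnj (Y \<omega>)) = (LINT \<omega>|M. X \<omega>) * cnj (LINT \<omega>|M. Y \<omega>)"
  using indep_var_moment_products(2)[OF assms(1), of "\<lambda>z. z" cnj] assms by simp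

end

context ar_observation
begin

abbreviation r :: "int \<Rightarrow> complex" where
  "r \<equiv> autocov M vx h"

lemma h_moments:
  assumes "n < Nr" "finite F"
  shows "gaussian_moments M (\<lambda>\<omega>. \<Sum>t\<in>F. c t * h n t \<omega>)"
  using gaussian_moments_circular_process[OF h_gaussian h_zero_mean] assms by blast

lemma h_moments_single: "n < Nr \<Longrightarrow> gaussian_moments M (h n t)"
  using h_moments[of n "{t}" "\<lambda>_. 1"] by simp

lemma h_measurable[measurable]: "n < Nr \<Longrightarrow> h n t \<in> borel_measurable M"
  using h_moments_single by (simp add: gaussian_moments_def)

lemma h_mean: "n < Nr \<Longrightarrow> (LINT \<omega>|M. h n t \<omega>) = 0"
  using h_moments_single by (simp add: gaussian_moments_def)

lemma h_cov:
  assumes "n < Nr"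
  shows "(LINT \<omega>|M. h n t \<omega> * cnj (h n s \<omega>)) = complex_of_real vx * r (t - s)"
  using autocov_eq[OF assms, of "t - s" t] vx_pos by simp

lemma h_cov_integrable: "n < Nr \<Longrightarrow> integrable M (\<lambda>\<omega>. h n t \<omega> * cnj (h n s \<omega>))"
  by (intro gaussian_moments_integrable_mult_cnj h_moments_single)

text \<open>\<open>r 0\<close> has complex type but is a nonnegative real number, so its modulus
  stands for it.\<close>

lemma h_variance:
  assumes "n < Nr"
  shows "(LINT \<omega>|M. (cmod (h n t \<omega>))\<^sup>2) = vx * cmod (r 0)"
proof -
  have "complex_of_real (LINT \<omega>|M. (cmod (h n t \<omega>))\<^sup>2) = complex_of_real vx * r 0"
    using h_cov[OF assms, of t t]
    by (simp add: complex_norm_square[symmetric] del: of_real_power)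
  from arg_cong[OF this, of cmod] show ?thesis
    using vx_pos by (simp add: norm_mult)
qed

text \<open>By stationarity both factors have the same variance, so the inequality 2xy \<le> x^2 +
  y^2 already gives the Cauchy-Schwarz bound. It holds at all lags, including those outside the
  window of the summability assumption, as \<open>recursion_decay\<close> requires.\<close>

lemma cmod_autocov_le: "cmod (r k) \<le> cmod (r 0)"
proof -
  have n: "0 < Nr" using Nr_pos by simp
  have "vx * cmod (r k) = cmod (LINT \<omega>|M. h 0 k \<omega> * cnj (h 0 0 \<omega>))"
    using h_cov[OF n, of k 0] vx_pos by (simp add: norm_mult)
  also have "\<dots> \<le> (LINT \<omega>|M. cmod (h 0 k \<omega> * cnj (h 0 0 \<omega>)))"
    by (rule integral_norm_bound)
  also have "\<dots> \<le> (LINT \<omega>|M. ((cmod (h 0 k \<omega>))\<^sup>2 + (cmod (h 0 0 \<omega>))\<^sup>2) / 2)"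
  proof (rule integral_mono)
    show "integrable M (\<lambda>\<omega>. cmod (h 0 k \<omega> * cnj (h 0 0 \<omega>)))"
      using h_cov_integrable[OF n] by (rule integrable_norm)
    show "integrable M (\<lambda>\<omega>. ((cmod (h 0 k \<omega>))\<^sup>2 + (cmod (h 0 0 \<omega>))\<^sup>2) / 2)"
      using gaussian_moments_integrable(2)[OF h_moments_single[OF n]] by simp
    show "cmod (h 0 k \<omega> * cnj (h 0 0 \<omega>)) \<le> ((cmod (h 0 k \<omega>))\<^sup>2 + (cmod (h 0 0 \<omega>))\<^sup>2) / 2" for \<omega>
      using sum_squares_bound[of "cmod (h 0 k \<omega>)" "cmod (h 0 0 \<omega>)"] by (simp add: norm_mult)
  qed
  also have "\<dots> = vx * cmod (r 0)"
    using gaussian_moments_integrable(2)[OF h_moments_single[OF n]] by (simp add: h_variance[OF n])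
  finally show ?thesis using vx_pos by simp
qed

lemma autocov_minus: "r (- k) = cnj (r k)"
proof -
  have n: "0 < Nr" using Nr_pos by simp
  have "complex_of_real vx * r (- k) = (LINT \<omega>|M. cnj (h 0 k \<omega> * cnj (h 0 0 \<omega>)))"
    using h_cov[OF n, of 0 k] by (simp add: mult.commute)
  also have "\<dots> = cnj (LINT \<omega>|M. h 0 k \<omega> * cnj (h 0 0 \<omega>))"
    by (rule Bochner_Integration.integral_cnj)
  finally show ?thesis using h_cov[OF n, of k 0] vx_pos by simp
qed

text \<open>The sigma-algebra of a single past value is contained in that of the whole past path,
  and independence passes to smaller sigma-algebras.\<close>

lemma innovation_indep_past:
  assumes n: "n < Nr" and "s < t"
  shows "indep_var borel (x n t) borel (h n s)"
proof -
  let ?past = "vimage_algebra (space M) (\<lambda>\<omega>. \<lambda>s\<in>{..<t}. h n s \<omega>) (PiM {..<t} (\<lambda>_. borel))"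
  have "sigma_sets (space M) {h n s -` A \<inter> space M | A. A \<in> sets borel} \<subseteq> sets ?past"
  proof (rule sets.sigma_sets_subset[of _ ?past, simplified], clarify)
    fix A :: "complex set" assume "A \<in> sets borel"
    then have "(\<lambda>f. f s) -` A \<inter> space (PiM {..<t} (\<lambda>_. borel)) \<in> sets (PiM {..<t} (\<lambda>_. borel))"
      using \<open>s < t\<close> by (intro measurable_sets[of _ _ borel]) auto
    from in_vimage_algebra[OF this, of "\<lambda>\<omega>. \<lambda>s\<in>{..<t}. h n s \<omega>" "space M"]
    show "h n s -` A \<inter> space M \<in> sets ?past"
      using \<open>s < t\<close> by (simp add: vimage_def space_PiM Int_def conj_commute)
  qed
  then show ?thesis
    using x_indep_past[OF n, of t] x_law[OF n, of t] n
    unfolding indep_var_eq sets_vimage_algebra[symmetric, of "space M" "x n t"] indep_set_def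
    by (auto simp: cn_distributed_def split: bool.splits elim!: indep_sets_mono_sets)
qed

text \<open>The everywhere defined representative of the innovation \<open>x n t\<close>.\<close>

definition residual :: "nat \<Rightarrow> int \<Rightarrow> 'a \<Rightarrow> complex" where
  "residual n t \<omega> = h n t \<omega> - (\<Sum>i=1..p. complex_of_real (a i) * h n (t - int i) \<omega>)"

lemma residual_AE:
  assumes "n < Nr"
  shows "AE \<omega> in M. residual n t \<omega> = x n t \<omega>"
  using ar_equation[OF assms, of t] by eventually_elim (simp add: residual_def)

lemma residual_measurable[measurable]: "n < Nr \<Longrightarrow> residual n t \<in> borel_measurable M"
  unfolding residual_def by measurable

lemma x_moments: "n < Nr \<Longrightarrow> gaussian_moments M (x n t)" "n < Nr \<Longrightarrow> (LINT \<omega>|M. (cmod (x n t \<omega>))\<^sup>2) = vx"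
  using cn_distributed_moments[OF x_law] vx_pos by (auto intro: less_imp_le)

lemma x_measurable[measurable]: "n < Nr \<Longrightarrow> x n t \<in> borel_measurable M"
  using x_moments by (simp add: gaussian_moments_def)

lemma residual_variance:
  assumes n: "n < Nr"
  shows "integrable M (\<lambda>\<omega>. (cmod (residual n t \<omega>))\<^sup>2)" "(LINT \<omega>|M. (cmod (residual n t \<omega>))\<^sup>2) = vx"
proof -
  note [measurable] = residual_measurable[OF n] x_measurable[OF n]
  have ae: "AE \<omega> in M. (cmod (residual n t \<omega>))\<^sup>2 = (cmod (x n t \<omega>))\<^sup>2"
    using residual_AE[OF n, of t] by eventually_elim simp
  show "integrable M (\<lambda>\<omega>. (cmod (residual n t \<omega>))\<^sup>2)"
    using ae gaussian_moments_integrable(2)[OF x_moments(1)[OF n]]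
    by (subst integrable_cong_AE[OF _ _ ae]) auto
  show "(LINT \<omega>|M. (cmod (residual n t \<omega>))\<^sup>2) = vx"
    by (subst integral_cong_AE[OF _ _ ae]) (auto simp: x_moments n)
qed

lemma residual_orthogonal_past:
  assumes n: "n < Nr" and "s < t"
  shows "integrable M (\<lambda>\<omega>. residual n t \<omega> * cnj (h n s \<omega>))"
    "(LINT \<omega>|M. residual n t \<omega> * cnj (h n s \<omega>)) = 0"
proof -
  note [measurable] = residual_measurable[OF n] x_measurable[OF n] h_measurable[OF n]
  have ae: "AE \<omega> in M. residual n t \<omega> * cnj (h n s \<omega>) = x n t \<omega> * cnj (h n s \<omega>)"
    using residual_AE[OF n, of t] by eventually_elim simp
  show "integrable M (\<lambda>\<omega>. residual n t \<omega> * cnj (h n s \<omega>))"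
    by (subst integrable_cong_AE[OF _ _ ae])
       (auto intro: gaussian_moments_integrable_mult_cnj x_moments h_moments_single n)
  show "(LINT \<omega>|M. residual n t \<omega> * cnj (h n s \<omega>)) = 0"
    using indep_var_cov_0[OF innovation_indep_past[OF assms]
        gaussian_moments_integrable(1)[OF x_moments(1)[OF n]]
        gaussian_moments_integrable(1)[OF h_moments_single[OF n]]]
    by (subst integral_cong_AE[OF _ _ ae]) (auto simp: h_mean n)
qed

text \<open>The Yule-Walker equations: at a positive lag the innovation is orthogonal to
  \<open>h 0 0\<close>, whereas at lag 0 it would contribute its own variance.\<close>

lemma autocov_recursion:
  assumes "k \<ge> 1"
  shows "r k = (\<Sum>i=1..p. complex_of_real (a i) * r (k - int i))"
proof -
  have n: "0 < Nr" using Nr_pos by simp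
  have "0 = (LINT \<omega>|M. residual 0 k \<omega> * cnj (h 0 0 \<omega>))"
    using residual_orthogonal_past[OF n, of 0 k] assms by simp
  also have "\<dots> = (LINT \<omega>|M. h 0 k \<omega> * cnj (h 0 0 \<omega>) -
      (\<Sum>i=1..p. complex_of_real (a i) * (h 0 (k - int i) \<omega> * cnj (h 0 0 \<omega>))))"
    by (simp add: residual_def left_diff_distrib sum_distrib_right mult.assoc)
  also have "\<dots> = complex_of_real vx * r k - (\<Sum>i=1..p. complex_of_real (a i) * (complex_of_real vx * r (k - int i)))"
    using h_cov_integrable[OF n] by (simp add: h_cov[OF n] Bochner_Integration.integral_sum)
  also have "\<dots> = complex_of_real vx * (r k - (\<Sum>i=1..p. complex_of_real (a i) * r (k - int i)))"
    by (simp add: right_diff_distrib sum_distrib_left mult.left_commute)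
  finally show ?thesis using vx_pos by simp
qed

text \<open>Unrolling the autoregression \<open>m\<close> times writes \<open>h 0 0\<close> as a combination of the pairwise
  orthogonal innovations \<open>x 0 0\<close>, ..., \<open>x 0 (1 - m)\<close> and of an orthogonal remainder in the past;
  hence the impulse response is square summable, without any analysis of the characteristic roots.\<close>

lemma impulse_response_energy:
  "vx * (\<Sum>l<m. (companion_row p a l 1)\<^sup>2) +
     (LINT \<omega>|M. (cmod (\<Sum>i=1..p. complex_of_real (companion_row p a m i) * h 0 (- int m - int i + 1) \<omega>))\<^sup>2)
   = vx * cmod (r 0)"
proof (induction m)
  have n: "0 < Nr" using Nr_pos by simp
  case 0
  have "(\<Sum>i=1..p. complex_of_real (companion_row p a 0 i) * h 0 (- int 0 - int i + 1) \<omega>) =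
      (\<Sum>i=1..p. if i = 1 then h 0 0 \<omega> else 0)" for \<omega>
    by (rule sum.cong) auto
  then show ?case using order_pos h_variance[OF n, of 0] by simp
next
  have n: "0 < Nr" using Nr_pos by simp
  case (Suc m)
  let ?c = "complex_of_real (companion_row p a m 1)"
  let ?Y = "\<lambda>\<omega>. \<Sum>i=1..p. complex_of_real (companion_row p a (Suc m) i) * h 0 (- int m - int i) \<omega>"
  note [measurable] = residual_measurable[OF n] h_measurable[OF n]
  have step: "(\<Sum>i=1..p. complex_of_real (companion_row p a m i) * h 0 (- int m - int i + 1) \<omega>) =
      ?c * residual 0 (- int m) \<omega> + ?Y \<omega>" for \<omega>
    using companion_row_step[OF order_pos, of a m "\<lambda>t. h 0 t \<omega>" "- int m"]
    by (simp only: residual_def)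
  have past: "integrable M (\<lambda>\<omega>. residual 0 (- int m) \<omega> * cnj (h 0 (- int m - int i) \<omega>))"
    "(LINT \<omega>|M. residual 0 (- int m) \<omega> * cnj (h 0 (- int m - int i) \<omega>)) = 0" if "i \<in> {1..p}" for i
    using residual_orthogonal_past[OF n, of "- int m - int i" "- int m"] that by auto
  have expand: "?c * residual 0 (- int m) \<omega> * cnj (?Y \<omega>) = (\<Sum>i=1..p. (?c * complex_of_real (companion_row p a (Suc m) i)) *
     (residual 0 (- int m) \<omega> * cnj (h 0 (- int m - int i) \<omega>)))" for \<omega>
    by (simp only: cnj_sum complex_cnj_mult complex_cnj_complex_of_real sum_distrib_left mult_ac)
  have Y: "gaussian_moments M ?Y"
  proof -
    \<comment> \<open>The sum over the delays \<open>i\<close> becomes a sum over times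
      \<open>t\<close>, the form that \<open>h_moments\<close> accepts;
      \<open>nat (- int m - t)\<close> recovers the delay.\<close>
    have "?Y \<omega> = (\<Sum>t\<in>(\<lambda>i. - int m - int i) ` {1..p}.
       complex_of_real (companion_row p a (Suc m) (nat (- int m - t))) * h 0 t \<omega>)" for \<omega>
      by (subst sum.reindex) (auto simp: inj_on_def simp del: companion_row.simps)
    then show ?thesis using h_moments[OF n] by simp
  qed
  have "(LINT \<omega>|M. (cmod (?c * residual 0 (- int m) \<omega> + ?Y \<omega>))\<^sup>2) =
     (LINT \<omega>|M. (cmod (?c * residual 0 (- int m) \<omega>))\<^sup>2) + (LINT \<omega>|M. (cmod (?Y \<omega>))\<^sup>2)"
  proof (rule second_moment_add_orthogonal)
    show "integrable M (\<lambda>\<omega>. (cmod (?c * residual 0 (- int m) \<omega>))\<^sup>2)"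
      using residual_variance(1)[OF n] by (simp add: norm_mult power_mult_distrib)
    show "integrable M (\<lambda>\<omega>. (cmod (?Y \<omega>))\<^sup>2)"
      using Y by (rule gaussian_moments_integrable)
    show "integrable M (\<lambda>\<omega>. ?c * residual 0 (- int m) \<omega> * cnj (?Y \<omega>))"
      unfolding expand using past
      by (intro Bochner_Integration.integrable_sum integrable_mult_right) auto
    show "(LINT \<omega>|M. ?c * residual 0 (- int m) \<omega> * cnj (?Y \<omega>)) = 0"
      unfolding expand using past
      by (subst Bochner_Integration.integral_sum) (auto intro!: integrable_mult_right sum.neutral)
  qed
  also have "(LINT \<omega>|M. (cmod (?c * residual 0 (- int m) \<omega>))\<^sup>2) = vx * (companion_row p a m 1)\<^sup>2"
    by (simp add: norm_mult power_mult_distrib residual_variance[OF n])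
  finally have *: "(LINT \<omega>|M. (cmod (?c * residual 0 (- int m) \<omega> + ?Y \<omega>))\<^sup>2) =
    vx * (companion_row p a m 1)\<^sup>2 + (LINT \<omega>|M. (cmod (?Y \<omega>))\<^sup>2)" .
  have index: "- int (Suc m) - int i + 1 = - int m - int i" for i by simp
  show ?case
    using Suc.IH unfolding step * index by (simp only: sum.lessThan_Suc distrib_left)
qed

text \<open>The conclusion concerns the coefficients \<open>a\<close> alone; the existence of a
  stationary causal solution proves it. The energy of the remainder is nonnegative, so the partial
  sums of squares are bounded by the modulus of \<open>r 0\<close>.\<close>

lemma companion_row_vanishes: "(\<lambda>m. companion_row p a m 1) \<longlonglongrightarrow> 0"
proof -
  have "(\<Sum>l<m. (companion_row p a l 1)\<^sup>2) \<le> cmod (r 0)" for m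
  proof -
    have "vx * (\<Sum>l<m. (companion_row p a l 1)\<^sup>2) \<le> vx * cmod (r 0)"
      unfolding impulse_response_energy[of m, symmetric] by (simp add: integral_nonneg_AE)
    then show ?thesis using vx_pos by simp
  qed
  then have "summable (\<lambda>l. (companion_row p a l 1)\<^sup>2)"
    by (intro summableI_nonneg_bounded) auto
  then have "(\<lambda>l. (companion_row p a l 1)\<^sup>2) \<longlonglongrightarrow> 0" by (rule summable_LIMSEQ_zero)
  then have "(\<lambda>l. \<bar>companion_row p a l 1\<bar>) \<longlonglongrightarrow> 0"
    using tendsto_real_sqrt[of _ 0] by fastforce
  then show ?thesis by (rule tendsto_rabs_zero_cancel)
qed

lemma autocov_decay:
  assumes "cmod (r 0) \<le> K" and "(\<Sum>i=1..p. \<bar>companion_row p a N i\<bar>) \<le> 1 / 2"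
  shows "real_of_int \<bar>k\<bar> * cmod (r k) \<le> 2 * real (N + p) * K"
proof -
  have "real (nat \<bar>k\<bar>) * cmod (r (int (nat \<bar>k\<bar>))) \<le> 2 * real (N + p) * K"
    using order_trans[OF cmod_autocov_le assms(1)]
    by (intro recursion_decay[OF order_pos autocov_recursion _ assms(2)])
  \<comment> \<open>The recursion covers positive lags only; Hermitian symmetry supplies the
    negative ones.\<close>
  moreover have "cmod (r \<bar>k\<bar>) = cmod (r k)"
    by (cases "k \<ge> 0") (auto simp: autocov_minus)
  ultimately show ?thesis by simp
qed

end

section \<open>Variance of a sesquilinear sum\<close>

context gaussian_moment_space
begin

text \<open>Wick's formula turns E |S|^2 into two double sums. The pairing of each
  \<open>f i\<close> with its own \<open>g i\<close> adds up to |m|^2, which the centring removes;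
  the pairing across \<open>i\<close> and \<open>j\<close> is the variance.\<close>

lemma variance_sesquilinear_sum:
  assumes J: "finite J" and f: "\<And>j. j \<in> J \<Longrightarrow> f j \<in> V" and g: "\<And>j. j \<in> J \<Longrightarrow> g j \<in> V"
  defines "S \<equiv> \<lambda>\<omega>. \<Sum>j\<in>J. f j \<omega> * cnj (g j \<omega>)"
  defines "m \<equiv> \<Sum>j\<in>J. cov (f j) (g j)"
  shows "integrable M (\<lambda>\<omega>. (cmod (S \<omega> - m))\<^sup>2)"
    and "complex_of_real (LINT \<omega>|M. (cmod (S \<omega> - m))\<^sup>2) =
      (\<Sum>i\<in>J. \<Sum>j\<in>J. cov (f i) (f j) * cov (g j) (g i))"
proof -
  have iS: "integrable M S" and eS: "(LINT \<omega>|M. S \<omega>) = m"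
    unfolding S_def m_def using f g int2
    by (auto intro!: Bochner_Integration.integrable_sum simp: Bochner_Integration.integral_sum)
  have SS: "S \<omega> * cnj (S \<omega>) = (\<Sum>i\<in>J. \<Sum>j\<in>J. f i \<omega> * g j \<omega> * cnj (f j \<omega>) * cnj (g i \<omega>))" for \<omega>
    unfolding S_def cnj_sum sum_product by (simp add: mult_ac)
  have i4: "integrable M (\<lambda>\<omega>. f i \<omega> * g j \<omega> * cnj (f j \<omega>) * cnj (g i \<omega>))" if "i \<in> J" "j \<in> J" for i j
    using f g that by (intro int4) auto
  have iSS: "integrable M (\<lambda>\<omega>. S \<omega> * cnj (S \<omega>))"
    unfolding SS using i4 by (intro Bochner_Integration.integrable_sum)
  have "(LINT \<omega>|M. S \<omega> * cnj (S \<omega>)) = (\<Sum>i\<in>J. \<Sum>j\<in>J. LINT \<omega>|M. f i \<omega> * g j \<omega> * cnj (f j \<omega>) * cnj (g i \<omega>))"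
    unfolding SS using i4
    by (subst Bochner_Integration.integral_sum)
       (auto intro!: Bochner_Integration.integrable_sum sum.cong Bochner_Integration.integral_sum)
  also have "\<dots> = (\<Sum>i\<in>J. \<Sum>j\<in>J. cov (f i) (f j) * cov (g j) (g i) + cov (f i) (g i) * cov (g j) (f j))"
    using f g by (intro sum.cong refl wick) auto
  also have "\<dots> = (\<Sum>i\<in>J. \<Sum>j\<in>J. cov (f i) (f j) * cov (g j) (g i)) + m * (\<Sum>j\<in>J. cov (g j) (f j))"
    by (simp add: sum.distrib m_def sum_product)
  also have "(\<Sum>j\<in>J. cov (g j) (f j)) = cnj m"
    by (simp add: m_def cnj_sum flip: Bochner_Integration.integral_cnj) (simp add: mult.commute)
  finally have eSS: "(LINT \<omega>|M. S \<omega> * cnj (S \<omega>)) =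
      (\<Sum>i\<in>J. \<Sum>j\<in>J. cov (f i) (f j) * cov (g j) (g i)) + m * cnj m" .
  have ex: "complex_of_real ((cmod (z - m))\<^sup>2) = z * cnj z - z * cnj m - m * cnj z + m * cnj m" for z
    unfolding complex_norm_square by (simp add: algebra_simps)
  have "integrable M (\<lambda>\<omega>. complex_of_real ((cmod (S \<omega> - m))\<^sup>2))"
    unfolding ex using iS iSS by simp
  then have "integrable M (\<lambda>\<omega>. Re (complex_of_real ((cmod (S \<omega> - m))\<^sup>2)))"
    by (rule integrable_Re)
  then show "integrable M (\<lambda>\<omega>. (cmod (S \<omega> - m))\<^sup>2)" by (simp only: Re_complex_of_real)
  have "complex_of_real (LINT \<omega>|M. (cmod (S \<omega> - m))\<^sup>2) = (LINT \<omega>|M. complex_of_real ((cmod (S \<omega> - m))\<^sup>2))"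
    by (simp only: integral_complex_of_real)
  also have "\<dots> = (\<Sum>i\<in>J. \<Sum>j\<in>J. cov (f i) (f j) * cov (g j) (g i))"
    unfolding ex using iS iSS eS eSS by (simp add: prob_space)
  finally show "complex_of_real (LINT \<omega>|M. (cmod (S \<omega> - m))\<^sup>2) =
      (\<Sum>i\<in>J. \<Sum>j\<in>J. cov (f i) (f j) * cov (g j) (g i))" .
qed

end

lemma (in prob_space) second_moment_tail_bound:
  fixes X :: "'a \<Rightarrow> complex"
  assumes X: "integrable M (\<lambda>\<omega>. (cmod (X \<omega>))\<^sup>2)" and e: "\<epsilon> > 0"
  shows "measure M {\<omega> \<in> space M. cmod (X \<omega>) \<ge> \<epsilon>} \<le> (LINT \<omega>|M. (cmod (X \<omega>))\<^sup>2) / \<epsilon>\<^sup>2"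
proof -
  have "{\<omega> \<in> space M. cmod (X \<omega>) \<ge> \<epsilon>} = {\<omega> \<in> space M. (cmod (X \<omega>))\<^sup>2 \<ge> \<epsilon>\<^sup>2}"
    using e by (auto intro: power_mono dest: power2_le_imp_le)
  moreover have "measure M {\<omega> \<in> space M. (cmod (X \<omega>))\<^sup>2 \<ge> \<epsilon>\<^sup>2} \<le> (LINT \<omega>|M. (cmod (X \<omega>))\<^sup>2) / \<epsilon>\<^sup>2"
    using e by (intro integral_Markov_inequality_measure[OF X, of "{}"]) auto
  ultimately show ?thesis by simp
qed

section \<open>Joint moments of the observations and the variance of lag sums\<close>

context ar_observation
begin

abbreviation sites :: "(nat \<times> int) set" where
  "sites \<equiv> {..<Nr} \<times> {0..int T - 1}"

definition site_obs :: "nat \<times> int \<Rightarrow> 'a \<Rightarrow> complex" where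
  "site_obs i \<omega> = observation h w \<omega> (fst i) (snd i)"

text \<open>The linear span is written with explicit coefficients, so that its closure properties
  are computations on coefficients.\<close>

definition observed :: "('a \<Rightarrow> complex) set" where
  "observed = {f. \<exists>c. f = (\<lambda>\<omega>. \<Sum>i\<in>sites. c i * site_obs i \<omega>)}"

lemma w_moments:
  "(n, t) \<in> sites \<Longrightarrow> gaussian_moments M (w n t)"
  "(n, t) \<in> sites \<Longrightarrow> (LINT \<omega>|M. (cmod (w n t \<omega>))\<^sup>2) = vw"
  using cn_distributed_moments[OF w_law vw_nonneg] by auto

text \<open>Joint Gaussianity is given only within one process \<open>h n\<close>. The combination
  is therefore split into noise and signal, and the signal into antennas; all these pieces are put
  together again by independence.\<close>

lemma observed_moments: "gaussian_moments M (\<lambda>\<omega>. \<Sum>i\<in>sites. c i * site_obs i \<omega>)"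
proof -
  define H where "H n \<omega> = (\<Sum>t\<in>{0..int T - 1}. c (n, t) * h n t \<omega>)" for n \<omega>
  define W where "W = (\<lambda>(n, t) \<omega>. c (n, t) * w n t \<omega>)"
  have split: "(\<Sum>i\<in>sites. c i * site_obs i \<omega>) = (\<Sum>i\<in>sites. W i \<omega>) + (\<Sum>n<Nr. H n \<omega>)" for \<omega>
  proof -
    have "(\<Sum>i\<in>sites. c i * site_obs i \<omega>) = (\<Sum>i\<in>sites. W i \<omega>) + (\<Sum>i\<in>sites. c i * (case i of (n, t) \<Rightarrow> h n t \<omega>))"
      unfolding sum.distrib[symmetric]
      by (intro sum.cong refl) (auto simp: site_obs_def observation_def W_def algebra_simps)
    also have "(\<Sum>i\<in>sites. c i * (case i of (n, t) \<Rightarrow> h n t \<omega>)) = (\<Sum>n<Nr. H n \<omega>)"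
      unfolding H_def sum.cartesian_product by (intro sum.cong) auto
    finally show ?thesis .
  qed
  have "indep_vars (\<lambda>_. borel) (\<lambda>n \<omega>. (\<Sum>t\<in>{0..int T - 1}. c (n, t) * h n t \<omega>)) {..<Nr}"
    by (rule indep_vars_compose2[OF h_indep, of "\<lambda>n f. \<Sum>t\<in>{0..int T - 1}. c (n, t) * f t"]) measurable
  then have "gaussian_moments M (\<lambda>\<omega>. \<Sum>n<Nr. H n \<omega>)"
    unfolding H_def by (rule gaussian_moments_sum[rotated]) (auto intro: h_moments)
  moreover have "gaussian_moments M (\<lambda>\<omega>. \<Sum>i\<in>sites. W i \<omega>)"
  proof (rule gaussian_moments_sum)
    have "indep_vars (\<lambda>_. borel) (\<lambda>i \<omega>. c i * (case i of (n, t) \<Rightarrow> w n t) \<omega>) sites"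
      by (rule indep_vars_compose2[OF w_indep, of "\<lambda>i z. c i * z"]) measurable
    then show "indep_vars (\<lambda>_. borel) W sites"
      by (rule indep_vars_cong[THEN iffD1, rotated -1]) (auto simp: W_def)
    show "gaussian_moments M (W i)" if "i \<in> sites" for i
      using that w_moments(1) by (auto simp: W_def intro: gaussian_moments_scale)
  qed simp
  moreover have "indep_var borel (\<lambda>\<omega>. \<Sum>i\<in>sites. W i \<omega>) borel (\<lambda>\<omega>. \<Sum>n<Nr. H n \<omega>)"
  proof -
    have "indep_var borel ((\<lambda>f. \<Sum>i\<in>sites. c i * f i) \<circ> (\<lambda>\<omega>. \<lambda>(n, t)\<in>sites. w n t \<omega>))
        borel ((\<lambda>f. \<Sum>n<Nr. \<Sum>t\<in>{0..int T - 1}. c (n, t) * f (n, t)) \<circ> (\<lambda>\<omega>. \<lambda>(n, t)\<in>{..<Nr} \<times> UNIV. h n t \<omega>))"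
      by (rule indep_var_compose[OF w_indep_h]) measurable
    moreover have "(\<lambda>f. \<Sum>i\<in>sites. c i * f i) \<circ> (\<lambda>\<omega>. \<lambda>(n, t)\<in>sites. w n t \<omega>) = (\<lambda>\<omega>. \<Sum>i\<in>sites. W i \<omega>)"
      by (auto simp: fun_eq_iff W_def intro!: sum.cong)
    moreover have "(\<lambda>f. \<Sum>n<Nr. \<Sum>t\<in>{0..int T - 1}. c (n, t) * f (n, t)) \<circ> (\<lambda>\<omega>. \<lambda>(n, t)\<in>{..<Nr} \<times> UNIV. h n t \<omega>)
       = (\<lambda>\<omega>. \<Sum>n<Nr. H n \<omega>)"
      by (auto simp: fun_eq_iff H_def intro!: sum.cong)
    ultimately show ?thesis by simp
  qed
  ultimately show ?thesis unfolding split by (intro gaussian_moments_add)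
qed

sublocale obs: gaussian_moment_space M observed
proof unfold_locales
  show "gaussian_moments M f" if "f \<in> observed" for f
    using that observed_moments by (auto simp: observed_def)
  show "(\<lambda>\<omega>. f \<omega> + g \<omega>) \<in> observed" if f: "f \<in> observed" and g: "g \<in> observed" for f g
  proof -
    obtain c d where "f = (\<lambda>\<omega>. \<Sum>i\<in>sites. c i * site_obs i \<omega>)" "g = (\<lambda>\<omega>. \<Sum>i\<in>sites. d i * site_obs i \<omega>)"
      using f g by (auto simp: observed_def)
    then have "(\<lambda>\<omega>. f \<omega> + g \<omega>) = (\<lambda>\<omega>. \<Sum>i\<in>sites. (c i + d i) * site_obs i \<omega>)"
      by (simp add: distrib_right sum.distrib)
    then show ?thesis unfolding observed_def by (intro CollectI exI[of _ "\<lambda>i. c i + d i"])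
  qed
  show "(\<lambda>\<omega>. u * f \<omega>) \<in> observed" if f: "f \<in> observed" for f u
  proof -
    obtain c where "f = (\<lambda>\<omega>. \<Sum>i\<in>sites. c i * site_obs i \<omega>)"
      using f by (auto simp: observed_def)
    then have "(\<lambda>\<omega>. u * f \<omega>) = (\<lambda>\<omega>. \<Sum>i\<in>sites. (u * c i) * site_obs i \<omega>)"
      by (simp add: sum_distrib_left mult.assoc)
    then show ?thesis unfolding observed_def by (intro CollectI exI[of _ "\<lambda>i. u * c i"])
  qed
qed

lemma site_obs_observed:
  assumes "i \<in> sites"
  shows "site_obs i \<in> observed"
proof -
  have "site_obs i \<omega> = (\<Sum>j\<in>sites. (if j = i then 1 else 0) * site_obs j \<omega>)" for \<omega>
  proof -
    have "(\<Sum>j\<in>sites. (if j = i then 1 else 0) * site_obs j \<omega>) = (\<Sum>j\<in>sites. if j = i then site_obs j \<omega> else 0)"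
      by (rule sum.cong) auto
    then show ?thesis using assms by (simp add: sum.delta)
  qed
  then have "site_obs i = (\<lambda>\<omega>. \<Sum>j\<in>sites. (if j = i then 1 else 0) * site_obs j \<omega>)" by (rule ext)
  then show ?thesis unfolding observed_def by (intro CollectI exI[of _ "\<lambda>j. if j = i then 1 else 0"])
qed

lemma w_h_indep:
  assumes "(n, t) \<in> sites" "m < Nr"
  shows "indep_var borel (w n t) borel (h m s)"
proof -
  have "indep_var borel ((\<lambda>f. f (n, t)) \<circ> (\<lambda>\<omega>. \<lambda>(n, t)\<in>sites. w n t \<omega>))
      borel ((\<lambda>f. f (m, s)) \<circ> (\<lambda>\<omega>. \<lambda>(n, t)\<in>{..<Nr} \<times> UNIV. h n t \<omega>))"
    using assms by (intro indep_var_compose[OF w_indep_h] measurable_component_singleton) auto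
  then show ?thesis using assms by (simp add: comp_def)
qed

lemma h_cov_distinct:
  assumes "n < Nr" "m < Nr" "n \<noteq> m"
  shows "(LINT \<omega>|M. h n t \<omega> * cnj (h m s \<omega>)) = 0"
proof -
  \<comment> \<open>Evaluating path \<open>n\<close> at \<open>t\<close> and all other paths at
    \<open>s\<close> yields both variables from one independent family.\<close>
  have "indep_vars (\<lambda>_. borel) (\<lambda>k \<omega>. h k (if k = n then t else s) \<omega>) {..<Nr}"
    by (rule indep_vars_compose2[OF h_indep, of "\<lambda>k f. f (if k = n then t else s)"]) measurable
  from indep_vars_pair_complex[OF this, of n m] assms
  have "indep_var borel (h n t) borel (h m s)" by simp
  from indep_var_cov_0[OF this] show ?thesis
    using gaussian_moments_integrable(1)[OF h_moments_single] h_mean assms by simp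
qed

lemma w_cov:
  assumes "i \<in> sites" "j \<in> sites"
  shows "(LINT \<omega>|M. case_prod w i \<omega> * cnj (case_prod w j \<omega>)) = (if i = j then complex_of_real vw else 0)"
proof (cases "i = j")
  case True
  then show ?thesis using w_moments(2) assms
    by (auto simp: complex_norm_square[symmetric] simp del: of_real_power)
next
  case False
  have "indep_var borel (case_prod w i) borel (case_prod w j)"
    using indep_vars_pair_complex[OF w_indep] assms False by auto
  from indep_var_cov_0[OF this] False show ?thesis
    using gaussian_moments_integrable(1)[OF w_moments(1)] w_moments(1) assms
    by (auto simp: gaussian_moments_def)
qed

definition obs_cov :: "int \<Rightarrow> complex" where
  "obs_cov k = complex_of_real vx * r k + (if k = 0 then complex_of_real vw else 0)"

lemma site_obs_cov:
  assumes "(n, t) \<in> sites" "(m, s) \<in> sites"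
  shows "obs.cov (site_obs (n, t)) (site_obs (m, s)) = (if n = m then obs_cov (t - s) else 0)"
proof -
  have n: "n < Nr" "m < Nr" using assms by auto
  note gm = h_moments_single[OF n(1), of t] h_moments_single[OF n(2), of s]
    w_moments(1)[OF assms(1)] w_moments(1)[OF assms(2)]
  note i1 = gm[THEN gaussian_moments_integrable(1)]
  have wh: "(LINT \<omega>|M. w n t \<omega> * cnj (h m s \<omega>)) = 0"
    using indep_var_cov_0[OF w_h_indep[OF assms(1) n(2)] i1(3) i1(2)] h_mean n by simp
  have "(LINT \<omega>|M. w m s \<omega> * cnj (h n t \<omega>)) = 0"
    using indep_var_cov_0[OF w_h_indep[OF assms(2) n(1)] i1(4) i1(1)] h_mean n by simp
  then have "cnj (LINT \<omega>|M. w m s \<omega> * cnj (h n t \<omega>)) = 0" by simp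
  then have hw: "(LINT \<omega>|M. h n t \<omega> * cnj (w m s \<omega>)) = 0"
    by (simp flip: Bochner_Integration.integral_cnj add: mult.commute)
  have "obs.cov (site_obs (n, t)) (site_obs (m, s)) = (LINT \<omega>|M. h n t \<omega> * cnj (h m s \<omega>) + h n t \<omega> * cnj (w m s \<omega>)
      + w n t \<omega> * cnj (h m s \<omega>) + w n t \<omega> * cnj (w m s \<omega>))"
    by (simp add: site_obs_def observation_def algebra_simps)
  also have "\<dots> = (LINT \<omega>|M. h n t \<omega> * cnj (h m s \<omega>)) + (LINT \<omega>|M. w n t \<omega> * cnj (w m s \<omega>))"
    using gm by (simp add: gaussian_moments_integrable_mult_cnj hw wh)
  also have "\<dots> = (if n = m then obs_cov (t - s) else 0)"
    using h_cov[OF n(1), of t s] h_cov_distinct[OF n] w_cov[OF assms] by (auto simp: obs_cov_def)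
  finally show ?thesis .
qed

lemma cmod_obs_cov_minus: "cmod (obs_cov (- k)) = cmod (obs_cov k)"
proof -
  have "obs_cov (- k) = cnj (obs_cov k)" by (simp add: obs_cov_def autocov_minus)
  then show ?thesis by simp
qed

lemma sum_obs_cov_le:
  assumes "(\<Sum>k=1 - int T..int T - 1. cmod (r k)) \<le> K"
  shows "(\<Sum>k=1 - int T..int T - 1. cmod (obs_cov k)) \<le> vx * K + vw"
proof -
  have "(\<Sum>k=1 - int T..int T - 1. cmod (obs_cov k)) \<le>
     (\<Sum>k=1 - int T..int T - 1. vx * cmod (r k) + (if k = 0 then vw else 0))"
    unfolding obs_cov_def using vx_pos vw_nonneg
    by (intro sum_mono order_trans[OF norm_triangle_ineq]) (auto simp: norm_mult)
  also have "\<dots> = vx * (\<Sum>k=1 - int T..int T - 1. cmod (r k)) + vw"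
    using T_pos by (simp add: sum.distrib sum_distrib_left sum.delta)
  also have "\<dots> \<le> vx * K + vw" using assms vx_pos by simp
  finally show ?thesis .
qed

definition lags :: "int \<Rightarrow> int set" where
  "lags k = {t. t \<in> {0..int T - 1} \<and> t + k \<in> {0..int T - 1}}"

lemma lags_subset: "lags k \<subseteq> {0..int T - 1}"
  by (auto simp: lags_def)

lemma finite_lags: "finite (lags k)"
  using lags_subset by (rule finite_subset) simp

lemma card_lags:
  assumes "k \<in> {1 - int T..int T - 1}"
  shows "real (card (lags k)) = real T - real_of_int \<bar>k\<bar>"
proof -
  have "lags k = {max 0 (- k)..min (int T - 1) (int T - 1 - k)}" by (auto simp: lags_def)
  then show ?thesis using assms by (auto simp: max_def min_def)
qed

lemma lag_sum_eq:
  "lag_sum Nr T (observation h w \<omega>) k =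
     (\<Sum>(n, t)\<in>{..<Nr} \<times> lags k. site_obs (n, t + k) \<omega> * cnj (site_obs (n, t) \<omega>))"
  by (simp add: lag_sum_def lags_def sum.cartesian_product site_obs_def)

text \<open>Sites on different antennas are uncorrelated. On one antenna the shift by
  \<open>k\<close> cancels, and the pair \<open>t\<close>, \<open>s\<close> contributes
  \<open>obs_cov (t - s) * obs_cov (s - t)\<close>. One factor is bounded by \<open>G\<close> and
  the other sums over \<open>s\<close> to at most \<open>G\<close>; there are \<open>Nr * L\<close>
  rows.\<close>

lemma lag_sum_variance:
  assumes k: "k \<in> {1 - int T..int T - 1}"
    and K: "(\<Sum>k=1 - int T..int T - 1. cmod (r k)) \<le> K"
  defines "L \<equiv> real T - real_of_int \<bar>k\<bar>"
  defines "X \<equiv> \<lambda>\<omega>. lag_sum Nr T (observation h w \<omega>) k - complex_of_real (real Nr * L) * obs_cov k"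
  shows "integrable M (\<lambda>\<omega>. (cmod (X \<omega>))\<^sup>2)"
    and "(LINT \<omega>|M. (cmod (X \<omega>))\<^sup>2) \<le> real Nr * L * (vx * K + vw)\<^sup>2"
proof -
  define J where "J = {..<Nr} \<times> lags k"
  define f where "f = (\<lambda>(n, t). site_obs (n, t + k))"
  have J: "finite J" by (simp add: J_def finite_lags)
  have fJ: "(n, t + k) \<in> sites" and gJ: "(n, t) \<in> sites" if "(n, t) \<in> J" for n t
    using that by (auto simp: J_def lags_def)
  have f: "f j \<in> observed" and g: "site_obs j \<in> observed" if "j \<in> J" for j
    using site_obs_observed[OF fJ[of "fst j" "snd j"]] site_obs_observed[OF gJ[of "fst j" "snd j"]] that
    by (simp_all add: f_def case_prod_beta)
  have mean: "(\<Sum>j\<in>J. obs.cov (f j) (site_obs j)) = complex_of_real (real Nr * L) * obs_cov k"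
  proof -
    have "obs.cov (f j) (site_obs j) = obs_cov k" if "j \<in> J" for j
      using that site_obs_cov[OF fJ gJ] by (cases j) (auto simp: f_def)
    then have "(\<Sum>j\<in>J. obs.cov (f j) (site_obs j)) = (\<Sum>j\<in>J. obs_cov k)" by (intro sum.cong) auto
    also have "\<dots> = complex_of_real (real (card J)) * obs_cov k" by simp
    also have "real (card J) = real Nr * L"
      using card_lags[OF k] by (simp add: J_def card_cartesian_product L_def)
    finally show ?thesis .
  qed
  have X: "X = (\<lambda>\<omega>. (\<Sum>j\<in>J. f j \<omega> * cnj (site_obs j \<omega>)) - (\<Sum>j\<in>J. obs.cov (f j) (site_obs j)))"
    unfolding X_def mean lag_sum_eq J_def[symmetric] by (simp add: f_def case_prod_beta')
  note var = obs.variance_sesquilinear_sum[OF J f g, folded X]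
  show "integrable M (\<lambda>\<omega>. (cmod (X \<omega>))\<^sup>2)"
    using var(1) unfolding X by simp
  define G where "G = vx * K + vw"
  have sumG: "(\<Sum>j=1 - int T..int T - 1. cmod (obs_cov j)) \<le> G"
    unfolding G_def using K by (rule sum_obs_cov_le)
  have G: "cmod (obs_cov j) \<le> G" if "j \<in> {1 - int T..int T - 1}" for j
    using order_trans[OF member_le_sum[of j "{1 - int T..int T - 1}" "\<lambda>j. cmod (obs_cov j)"] sumG] that by simp
  have G0: "0 \<le> G" using order_trans[OF norm_ge_zero G[of 0]] T_pos by simp
  have row: "(\<Sum>s\<in>lags k. cmod (obs_cov (t - s)) * cmod (obs_cov (s - t))) \<le> G\<^sup>2" if t: "t \<in> lags k" for t
  proof -
    \<comment> \<open>These differences never leave the window of lags on which the assumption on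
      \<open>K\<close> gives control.\<close>
    have range: "t - s \<in> {1 - int T..int T - 1}" if "s \<in> lags k" for s
      using t that by (auto simp: lags_def)
    have "(\<Sum>s\<in>lags k. cmod (obs_cov (t - s)) * cmod (obs_cov (s - t))) \<le> (\<Sum>s\<in>lags k. cmod (obs_cov (t - s)) * G)"
    proof (intro sum_mono mult_left_mono)
      show "cmod (obs_cov (s - t)) \<le> G" if "s \<in> lags k" for s
        using G[OF range[OF that]] cmod_obs_cov_minus[of "t - s"] by simp
    qed simp
    also have "\<dots> = (\<Sum>j\<in>(\<lambda>s. t - s) ` lags k. cmod (obs_cov j)) * G"
      by (subst sum.reindex) (auto simp: inj_on_def sum_distrib_right)
    also have "\<dots> \<le> (\<Sum>j=1 - int T..int T - 1. cmod (obs_cov j)) * G"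
      using range G0 by (intro mult_right_mono sum_mono2) auto
    also have "\<dots> \<le> G * G" using sumG G0 by (rule mult_right_mono)
    finally show ?thesis by (simp add: power2_eq_square)
  qed
  have entry: "cmod (obs.cov (f i) (f j) * obs.cov (site_obs j) (site_obs i)) =
     (if fst i = fst j then cmod (obs_cov (snd i - snd j)) * cmod (obs_cov (snd j - snd i)) else 0)"
    if "i \<in> J" "j \<in> J" for i j
    using that site_obs_cov[OF fJ fJ] site_obs_cov[OF gJ gJ] by (cases i; cases j) (auto simp: f_def norm_mult)
  have "(LINT \<omega>|M. (cmod (X \<omega>))\<^sup>2) = cmod (complex_of_real (LINT \<omega>|M. (cmod (X \<omega>))\<^sup>2))"
    by (simp add: integral_nonneg_AE)
  also have "\<dots> = cmod (\<Sum>i\<in>J. \<Sum>j\<in>J. obs.cov (f i) (f j) * obs.cov (site_obs j) (site_obs i))"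
    using var(2) unfolding X by simp
  also have "\<dots> \<le> (\<Sum>i\<in>J. \<Sum>j\<in>J. cmod (obs.cov (f i) (f j) * obs.cov (site_obs j) (site_obs i)))"
    by (intro order_trans[OF norm_sum] sum_mono norm_sum)
  also have "\<dots> = (\<Sum>i\<in>J. \<Sum>j\<in>J. if fst i = fst j then cmod (obs_cov (snd i - snd j)) * cmod (obs_cov (snd j - snd i)) else 0)"
    by (intro sum.cong refl entry)
  also have "\<dots> \<le> (\<Sum>i\<in>J. G\<^sup>2)"
  proof (rule sum_mono)
    fix i assume i: "i \<in> J"
    have "(\<Sum>j\<in>J. if fst i = fst j then cmod (obs_cov (snd i - snd j)) * cmod (obs_cov (snd j - snd i)) else 0) =
        (\<Sum>m<Nr. \<Sum>s\<in>lags k. if m = fst i then cmod (obs_cov (snd i - s)) * cmod (obs_cov (s - snd i)) else 0)"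
      unfolding J_def sum.cartesian_product by (intro sum.cong) auto
    also have "\<dots> = (\<Sum>m<Nr. if m = fst i then (\<Sum>s\<in>lags k. cmod (obs_cov (snd i - s)) * cmod (obs_cov (s - snd i))) else 0)"
      by (intro sum.cong) auto
    also have "\<dots> \<le> G\<^sup>2" using i row by (auto simp: J_def sum.delta)
    finally show "(\<Sum>j\<in>J. if fst i = fst j then cmod (obs_cov (snd i - snd j)) * cmod (obs_cov (snd j - snd i)) else 0) \<le> G\<^sup>2" .
  qed
  also have "\<dots> = real Nr * L * G\<^sup>2"
    using card_lags[OF k] by (simp add: J_def card_cartesian_product L_def)
  finally show "(LINT \<omega>|M. (cmod (X \<omega>))\<^sup>2) \<le> real Nr * L * (vx * K + vw)\<^sup>2"
    by (simp add: G_def)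
qed

section \<open>Errors and tail bounds of the two estimates\<close>

lemma unbiased_error:
  assumes k: "k \<in> {1 - int T..int T - 1}"
  shows "unbiased_est vx vw Nr T H k - r k =
    (lag_sum Nr T H k - complex_of_real (real Nr * (real T - real_of_int \<bar>k\<bar>)) * obs_cov k) /
      complex_of_real (vx * real Nr * (real T - real_of_int \<bar>k\<bar>))"
proof -
  define L where "L = real T - real_of_int \<bar>k\<bar>"
  have nz: "vx \<noteq> 0" "real Nr \<noteq> 0" "L \<noteq> 0" using vx_pos Nr_pos k by (auto simp: L_def)
  \<comment> \<open>At lag 0 both normalisations agree, so one formula covers both branches of the
    definition.\<close>
  have L0: "L = real T" if "k = 0" using that by (simp add: L_def)
  have "unbiased_est vx vw Nr T H k =
      lag_sum Nr T H k / complex_of_real (vx * real Nr * L) - (if k = 0 then complex_of_real (vw / vx) else 0)"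
    using L0 by (auto simp: unbiased_est_def biased_est_def L_def)
  moreover have "complex_of_real (real Nr * L) * obs_cov k / complex_of_real (vx * real Nr * L) =
      r k + (if k = 0 then complex_of_real (vw / vx) else 0)"
    using nz by (simp add: obs_cov_def field_simps)
  ultimately show ?thesis unfolding L_def[symmetric] diff_divide_distrib by simp
qed

text \<open>The lag sum has mean \<open>real Nr * L * obs_cov k\<close> with L = T - |k|. Division
  by T instead of L leaves the bias |k| r(k) / T, while the correction by \<open>vw / vx\<close>
  cancels the noise at lag 0 exactly.\<close>

lemma biased_error:
  assumes k: "k \<in> {1 - int T..int T - 1}"
  shows "biased_est vx vw Nr T H k - r k =
    (lag_sum Nr T H k - complex_of_real (real Nr * (real T - real_of_int \<bar>k\<bar>)) * obs_cov k) /
      complex_of_real (vx * real Nr * real T) - complex_of_real (real_of_int \<bar>k\<bar> / real T) * r k"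
proof -
  define L where "L = real T - real_of_int \<bar>k\<bar>"
  have nz: "vx \<noteq> 0" "real Nr \<noteq> 0" "real T \<noteq> 0" using vx_pos Nr_pos T_pos by auto
  have "biased_est vx vw Nr T H k =
      lag_sum Nr T H k / complex_of_real (vx * real Nr * real T) - (if k = 0 then complex_of_real (vw / vx) else 0)"
    by (auto simp: biased_est_def)
  moreover have "complex_of_real (real Nr * L) * obs_cov k / complex_of_real (vx * real Nr * real T) =
      complex_of_real (L / real T) * r k + (if k = 0 then complex_of_real (vw / vx) else 0)"
    using nz by (auto simp: obs_cov_def L_def field_simps)
  moreover have "complex_of_real (L / real T) * r k = r k - complex_of_real (real_of_int \<bar>k\<bar> / real T) * r k"
  proof -
    have "L / real T = 1 - real_of_int \<bar>k\<bar> / real T" using nz by (simp add: L_def diff_divide_distrib)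
    then show ?thesis by (simp add: left_diff_distrib)
  qed
  ultimately show ?thesis unfolding L_def[symmetric] diff_divide_distrib by simp
qed

text \<open>The variance bound Nr L G^2 with G = vx K + vw, divided by the squared normalisation (vx
  Nr L)^2, leaves one factor Nr L in the denominator.\<close>

lemma unbiased_tail:
  assumes k: "k \<in> {1 - int T..int T - 1}" and e: "\<epsilon> > 0"
    and K: "(\<Sum>k=1 - int T..int T - 1. cmod (r k)) \<le> K"
  shows "measure M {\<omega> \<in> space M. cmod (unbiased_est vx vw Nr T (observation h w \<omega>) k - r k) \<ge> \<epsilon>}
    \<le> ((vx * K + vw)\<^sup>2 / vx\<^sup>2) / (\<epsilon>\<^sup>2 * real Nr * (real T - real_of_int \<bar>k\<bar>))"
proof -
  define L where "L = real T - real_of_int \<bar>k\<bar>"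
  define X where "X \<omega> = lag_sum Nr T (observation h w \<omega>) k - complex_of_real (real Nr * L) * obs_cov k" for \<omega>
  have pos: "vx > 0" "real Nr > 0" "L > 0" using vx_pos Nr_pos k by (auto simp: L_def)
  note var = lag_sum_variance[OF k K, folded L_def, folded X_def]
  have err: "cmod (unbiased_est vx vw Nr T (observation h w \<omega>) k - r k) =
      cmod (X \<omega> / complex_of_real (vx * real Nr * L))" for \<omega>
    unfolding unbiased_error[OF k] X_def L_def ..
  have sq: "(cmod (X \<omega> / complex_of_real (vx * real Nr * L)))\<^sup>2 = (cmod (X \<omega>))\<^sup>2 / (vx * real Nr * L)\<^sup>2" for \<omega>
    unfolding norm_divide norm_of_real power_divide by simp
  have iX: "integrable M (\<lambda>\<omega>. (cmod (X \<omega> / complex_of_real (vx * real Nr * L)))\<^sup>2)"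
    unfolding sq using var(1) by simp
  have "measure M {\<omega> \<in> space M. cmod (X \<omega> / complex_of_real (vx * real Nr * L)) \<ge> \<epsilon>} \<le>
     (LINT \<omega>|M. (cmod (X \<omega>))\<^sup>2 / (vx * real Nr * L)\<^sup>2) / \<epsilon>\<^sup>2"
    unfolding sq[symmetric] using iX e by (rule second_moment_tail_bound)
  also have "\<dots> \<le> (real Nr * L * (vx * K + vw)\<^sup>2 / (vx * real Nr * L)\<^sup>2) / \<epsilon>\<^sup>2"
    unfolding integral_divide_zero using var(2) by (intro divide_right_mono) auto
  also have "\<dots> = ((vx * K + vw)\<^sup>2 / vx\<^sup>2) / (\<epsilon>\<^sup>2 * real Nr * L)"
    using pos e by (simp add: power2_eq_square)
  finally show ?thesis unfolding err L_def .
qed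

text \<open>The inequality |u - v|^2 \<le> 2 |u|^2 + 2 |v|^2 separates fluctuation from bias and
  explains both factors 2. \<open>D\<close> controls the bias and \<open>B\<close> converts its
  order 1/T^2 into 1/(Nr T).\<close>

lemma biased_tail:
  assumes k: "k \<in> {1 - int T..int T - 1}" and e: "\<epsilon> > 0"
    and K: "(\<Sum>k=1 - int T..int T - 1. cmod (r k)) \<le> K"
    and D: "real_of_int \<bar>k\<bar> * cmod (r k) \<le> D" and B: "real Nr \<le> B * real T"
  shows "measure M {\<omega> \<in> space M. cmod (biased_est vx vw Nr T (observation h w \<omega>) k - r k) \<ge> \<epsilon>}
    \<le> (2 * (vx * K + vw)\<^sup>2 / vx\<^sup>2 + 2 * D\<^sup>2 * B) / (\<epsilon>\<^sup>2 * real Nr * real T)"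
proof -
  define L where "L = real T - real_of_int \<bar>k\<bar>"
  define X where "X \<omega> = lag_sum Nr T (observation h w \<omega>) k - complex_of_real (real Nr * L) * obs_cov k" for \<omega>
  define q where "q = vx * real Nr * real T"
  define b where "b = complex_of_real (real_of_int \<bar>k\<bar> / real T) * r k"
  have pos: "vx > 0" "real Nr > 0" "real T > 0" "q > 0" using vx_pos Nr_pos T_pos by (auto simp: q_def)
  note var = lag_sum_variance[OF k K, folded L_def, folded X_def]
  have err: "cmod (biased_est vx vw Nr T (observation h w \<omega>) k - r k) = cmod (X \<omega> / complex_of_real q - b)" for \<omega>
    unfolding biased_error[OF k] X_def L_def q_def b_def ..
  have sq: "(cmod (X \<omega> / complex_of_real q - b))\<^sup>2 \<le> 2 * (cmod (X \<omega>))\<^sup>2 / q\<^sup>2 + 2 * (cmod b)\<^sup>2" for \<omega>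
  proof -
    have "(cmod (u - v))\<^sup>2 \<le> 2 * (cmod u)\<^sup>2 + 2 * (cmod v)\<^sup>2" for u v :: complex
    proof -
      have "(cmod (u - v))\<^sup>2 \<le> (cmod u + cmod v)\<^sup>2"
        by (intro power_mono norm_triangle_ineq4) simp
      also have "\<dots> \<le> 2 * (cmod u)\<^sup>2 + 2 * (cmod v)\<^sup>2"
        using sum_squares_bound[of "cmod u" "cmod v"] by (simp add: power2_sum)
      finally show ?thesis .
    qed
    from this[of "X \<omega> / complex_of_real q" b] show ?thesis
      by (simp add: norm_divide power_divide)
  qed
  have iB: "integrable M (\<lambda>\<omega>. 2 * (cmod (X \<omega>))\<^sup>2 / q\<^sup>2 + 2 * (cmod b)\<^sup>2)"
    using var(1) by simp
  have [measurable]: "X \<in> borel_measurable M"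
  proof -
    have [measurable]: "site_obs i \<in> borel_measurable M" if "i \<in> sites" for i
      using obs.moments[OF site_obs_observed[OF that]] by (simp add: gaussian_moments_def)
    show ?thesis unfolding X_def lag_sum_eq case_prod_beta
      by (intro borel_measurable_diff borel_measurable_sum borel_measurable_times
            measurable_compose[OF _ borel_measurable_cnj] borel_measurable_const
            \<open>\<And>i. i \<in> sites \<Longrightarrow> site_obs i \<in> borel_measurable M\<close>) (auto simp: lags_def)
  qed
  have i: "integrable M (\<lambda>\<omega>. (cmod (X \<omega> / complex_of_real q - b))\<^sup>2)"
    by (rule Bochner_Integration.integrable_bound[OF iB])
       (auto intro!: AE_I2 order_trans[OF sq])
  have "(cmod b)\<^sup>2 \<le> D\<^sup>2 / (real T)\<^sup>2"
  proof -
    have "cmod b = real_of_int \<bar>k\<bar> * cmod (r k) / real T"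
      by (simp add: b_def norm_mult norm_divide)
    also have "\<dots> \<le> D / real T" using D by (intro divide_right_mono) auto
    finally have "(cmod b)\<^sup>2 \<le> (D / real T)\<^sup>2" by (intro power_mono) auto
    then show ?thesis by (simp add: power_divide)
  qed
  \<comment> \<open>Here 1/T^2 = (Nr/T) / (Nr T), and Nr/T is at most \<open>B\<close>.\<close>
  also have "\<dots> \<le> D\<^sup>2 * B / (real Nr * real T)"
  proof -
    have "D\<^sup>2 * real Nr \<le> D\<^sup>2 * (B * real T)" using B by (intro mult_left_mono) auto
    then show ?thesis using pos by (simp add: field_simps power2_eq_square)
  qed
  finally have b: "(cmod b)\<^sup>2 \<le> D\<^sup>2 * B / (real Nr * real T)" .
  have "(LINT \<omega>|M. (cmod (X \<omega> / complex_of_real q - b))\<^sup>2) \<le>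
      (LINT \<omega>|M. 2 * (cmod (X \<omega>))\<^sup>2 / q\<^sup>2 + 2 * (cmod b)\<^sup>2)"
    by (rule integral_mono[OF i iB sq])
  also have "\<dots> = 2 * (LINT \<omega>|M. (cmod (X \<omega>))\<^sup>2) / q\<^sup>2 + 2 * (cmod b)\<^sup>2"
    using var(1) by (simp add: prob_space)
  also have "\<dots> \<le> 2 * (real Nr * L * (vx * K + vw)\<^sup>2) / q\<^sup>2 + 2 * (D\<^sup>2 * B / (real Nr * real T))"
    using var(2) b by (intro add_mono divide_right_mono mult_left_mono) auto
  \<comment> \<open>The normalisation is by T, so L \<le> T loses nothing of the claimed order, even
    for lags close to T.\<close>
  also have "\<dots> \<le> 2 * (real Nr * real T * (vx * K + vw)\<^sup>2) / q\<^sup>2 + 2 * (D\<^sup>2 * B / (real Nr * real T))"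
    by (intro add_mono divide_right_mono mult_left_mono mult_right_mono) (auto simp: L_def)
  also have "\<dots> = (2 * (vx * K + vw)\<^sup>2 / vx\<^sup>2 + 2 * D\<^sup>2 * B) / (real Nr * real T)"
    using pos by (simp add: q_def power2_eq_square add_divide_distrib)
  finally have "(LINT \<omega>|M. (cmod (X \<omega> / complex_of_real q - b))\<^sup>2) / \<epsilon>\<^sup>2 \<le>
      (2 * (vx * K + vw)\<^sup>2 / vx\<^sup>2 + 2 * D\<^sup>2 * B) / (real Nr * real T) / \<epsilon>\<^sup>2"
    by (intro divide_right_mono) auto
  with second_moment_tail_bound[OF i e] show ?thesis
    unfolding err by (simp add: mult_ac)
qed

end

section \<open>Constants that are uniform over all models\<close>

theorem lemma1:
  fixes p :: nat and a :: "nat \<Rightarrow> real" and vx vw K c :: real and Nr :: "nat \<Rightarrow> nat"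
  assumes "p \<ge> 1" and "vx > 0" and "vw \<ge> 0" and "c > 0"
    and "filterlim Nr at_top sequentially"
    and "(\<lambda>T. real (Nr T) / real T) \<longlonglongrightarrow> c"
  shows "\<exists>K'>0. \<forall>T (M :: 'a measure) h x w.
    ar_observation M p a vx vw (Nr T) T h x w \<longrightarrow>
    (\<Sum>k=1 - int T..int T - 1. cmod (autocov M vx h k)) \<le> K \<longrightarrow>
    (\<forall>k\<in>{1 - int T..int T - 1}. \<forall>\<epsilon>>0.
      measure M {\<omega> \<in> space M.
          cmod (biased_est vx vw (Nr T) T (observation h w \<omega>) k - autocov M vx h k) \<ge> \<epsilon>}
        \<le> K' / (\<epsilon>\<^sup>2 * real (Nr T) * real T) \<and>
      measure M {\<omega> \<in> space M.
          cmod (unbiased_est vx vw (Nr T) T (observation h w \<omega>) k - autocov M vx h k) \<ge> \<epsilon>}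
        \<le> K' / (\<epsilon>\<^sup>2 * real (Nr T) * (real T - real_of_int \<bar>k\<bar>)))"
proof -
  \<comment> \<open>A convergent sequence is bounded throughout, so one \<open>B\<close> serves
    every \<open>T\<close>, not only large ones; at \<open>T = 0\<close> the quotient is 0 by
    convention.\<close>
  have "Bseq (\<lambda>T. real (Nr T) / real T)"
    using assms(6) by (intro convergent_imp_Bseq convergentI)
  then obtain B where B: "B > 0" "\<And>T. norm (real (Nr T) / real T) \<le> B" by (auto simp: Bseq_def)
  \<comment> \<open>\<open>N\<close> is chosen from \<open>p\<close> and \<open>a\<close> before any
    model is fixed, which keeps the constant uniform. That such an \<open>N\<close> exists is
    derived later, from whichever model is at hand; without a model the claim is vacuous.\<close>
  define N where "N = (SOME N. (\<Sum>i=1..p. \<bar>companion_row p a N i\<bar>) \<le> 1 / 2)"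
  define D where "D = 2 * real (N + p) * K"
  \<comment> \<open>The summand 1 ensures positivity: \<open>K\<close> is an arbitrary real number,
    and the other terms may vanish.\<close>
  define K' where "K' = 2 * (vx * K + vw)\<^sup>2 / vx\<^sup>2 + 2 * D\<^sup>2 * B + 1"
  have "0 \<le> 2 * D\<^sup>2 * B" "0 \<le> (vx * K + vw)\<^sup>2 / vx\<^sup>2" using B(1) by auto
  then have K': "0 < K'" "2 * (vx * K + vw)\<^sup>2 / vx\<^sup>2 + 2 * D\<^sup>2 * B \<le> K'"
    "(vx * K + vw)\<^sup>2 / vx\<^sup>2 \<le> K'"
    unfolding K'_def by linarith+
  show ?thesis
  proof (intro exI[of _ K'] conjI allI impI ballI K'(1))
    fix T M h x w k and \<epsilon> :: real
    assume model: "ar_observation (M :: 'a measure) p a vx vw (Nr T) T h x w"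
      and K: "(\<Sum>k=1 - int T..int T - 1. cmod (autocov M vx h k)) \<le> K"
      and k: "k \<in> {1 - int T..int T - 1}" and e: "0 < \<epsilon>"
    interpret ar_observation M p a vx vw "Nr T" T h x w by (rule model)
    have N: "(\<Sum>i=1..p. \<bar>companion_row p a N i\<bar>) \<le> 1 / 2"
      unfolding N_def using companion_row_small[OF companion_row_vanishes] by (rule someI_ex)
    \<comment> \<open>Lag 0 lies in the window because \<open>T\<close> is positive; so
      \<open>K\<close> bounds \<open>r 0\<close>, and with it every autocovariance.\<close>
    have "cmod (autocov M vx h 0) \<le> (\<Sum>k=1 - int T..int T - 1. cmod (autocov M vx h k))"
      using T_pos by (intro member_le_sum) auto
    with K have D: "real_of_int \<bar>k\<bar> * cmod (autocov M vx h k) \<le> D"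
      unfolding D_def by (intro autocov_decay N) auto
    have BT: "real (Nr T) \<le> B * real T"
      using B(2)[of T] T_pos by (simp add: pos_divide_le_eq)
    have "0 < \<epsilon>\<^sup>2 * real (Nr T)" using e Nr_pos by simp
    moreover have "0 < real T" "0 < real T - real_of_int \<bar>k\<bar>" using k by auto
    ultimately have nn: "0 \<le> \<epsilon>\<^sup>2 * real (Nr T) * real T"
      "0 \<le> \<epsilon>\<^sup>2 * real (Nr T) * (real T - real_of_int \<bar>k\<bar>)"
      by (auto intro!: mult_nonneg_nonneg less_imp_le)
    show "measure M {\<omega> \<in> space M.
          cmod (biased_est vx vw (Nr T) T (observation h w \<omega>) k - autocov M vx h k) \<ge> \<epsilon>}
        \<le> K' / (\<epsilon>\<^sup>2 * real (Nr T) * real T)"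
      by (rule order_trans[OF biased_tail[OF k e K D BT] divide_right_mono[OF K'(2) nn(1)]])
    show "measure M {\<omega> \<in> space M.
          cmod (unbiased_est vx vw (Nr T) T (observation h w \<omega>) k - autocov M vx h k) \<ge> \<epsilon>}
        \<le> K' / (\<epsilon>\<^sup>2 * real (Nr T) * (real T - real_of_int \<bar>k\<bar>))"
      by (rule order_trans[OF unbiased_tail[OF k e K] divide_right_mono[OF K'(3) nn(2)]])
  qed
qed

end
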